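(* Let $r \geq 2$ and let $M$ be an indecomposable $\mathcal{K}_r$-module. For $1 \leq d < r$ let $Q^d$ be the set of isomorphism classes $[N]$ of indecomposable $\mathcal{K}_r$-modules $N$ with dimension vector $(1,r-d)$. (a) If $1 \leq d < r$ and $[M] \in Q^d$, then there exists $U \in \mathrm{Gr}_{d,r}$ with $M \cong X_U$. (b) For $1 \leq d < r$ the map $\varphi\colon \mathrm{Gr}_{d,r} \to Q^d$, $U \mapsto [X_U]$, is bijective. (c) Let $1 \leq c \leq d < r$ and $[M] \in Q^d$. Then there are $[N] \in Q^c$ and an epimorphism $\pi\colon N \to M$.
   Context: $k$ is an algebraically closed field. $\Gamma_r$ is the quiver with vertices $1,2$ and $r$ arrows $\gamma_1,\dots,\gamma_r\colon 1 \to 2$; $\mathcal{K}_r = k\Gamma_r$ with idempotents $e_1,e_2$; modules are finite-dimensional left modules, and the dimension vector of $M$ is $(\dim_k e_1M,\dim_k e_2M)$. $P_1 = \mathcal{K}_re_2$ and $P_2 = \mathcal{K}_re_1$ are the indecomposable projectives (of dimension vectors $(0,1)$ and $(1,r)$). For $\alpha \in k^r$ put $x_\alpha = \sum_i\alpha_i\gamma_i \in P_2$. $\mathrm{Gr}_{d,r}$ is the set of $d$-dimensional subspaces of $k^r$. For $U \in \mathrm{Gr}_{d,r}$ with basis $u_1,\dots,u_d$, $X_U$ is the cokernel of the homomorphism $P_1^d \to P_2$ sending $e_2$ in the $i$-th coordinate to $x_{u_i}$; up to isomorphism it does not depend on the basis, and it is indecomposable with dimension vector $(1,r-d)$. *)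

theory Defs
  imports "HOL-Computational_Algebra.Polynomial" "HOL-Analysis.Cartesian_Space"
    "HOL-Algebra.AbelCoset" "HOL-Algebra.Module"
begin

section \<open>Left modules over a not necessarily commutative ring\<close>

text \<open>
  The library locale \<^locale>\<open>module\<close> of HOL-Algebra assumes a commutative ring of scalars.  We reuse
  its record type, but take the scalars from a type of class \<^class>\<open>ring_1\<close>.
  The record fields \<^const>\<open>mult\<close> and \<^const>\<open>one\<close>, inherited from rings, play no role.
\<close>

locale left_module = abelian_group M for M :: "('a::ring_1, 'm) module" +
  assumes smult_closed: "x \<in> carrier M \<Longrightarrow> a \<odot>\<^bsub>M\<^esub> x \<in> carrier M"
    and smult_l_distr: "x \<in> carrier M \<Longrightarrow> (a + b) \<odot>\<^bsub>M\<^esub> x = a \<odot>\<^bsub>M\<^esub> x \<oplus>\<^bsub>M\<^esub> b \<odot>\<^bsub>M\<^esub> x"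
    and smult_r_distr: "\<lbrakk>x \<in> carrier M; y \<in> carrier M\<rbrakk>
      \<Longrightarrow> a \<odot>\<^bsub>M\<^esub> (x \<oplus>\<^bsub>M\<^esub> y) = a \<odot>\<^bsub>M\<^esub> x \<oplus>\<^bsub>M\<^esub> a \<odot>\<^bsub>M\<^esub> y"
    and smult_assoc: "x \<in> carrier M \<Longrightarrow> (a * b) \<odot>\<^bsub>M\<^esub> x = a \<odot>\<^bsub>M\<^esub> (b \<odot>\<^bsub>M\<^esub> x)"
    and smult_one: "x \<in> carrier M \<Longrightarrow> 1 \<odot>\<^bsub>M\<^esub> x = x"

definition submodule_of :: "'m set \<Rightarrow> ('a::ring_1, 'm) module \<Rightarrow> bool" where
  "submodule_of S M \<longleftrightarrow> S \<subseteq> carrier M \<and> \<zero>\<^bsub>M\<^esub> \<in> S \<and>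
     (\<forall>x\<in>S. \<forall>y\<in>S. x \<oplus>\<^bsub>M\<^esub> y \<in> S) \<and> (\<forall>a. \<forall>x\<in>S. a \<odot>\<^bsub>M\<^esub> x \<in> S)"

definition module_homs :: "('a::ring_1, 'm) module \<Rightarrow> ('a, 'n) module \<Rightarrow> ('m \<Rightarrow> 'n) set" where
  "module_homs M N = {f \<in> carrier M \<rightarrow> carrier N.
     (\<forall>x\<in>carrier M. \<forall>y\<in>carrier M. f (x \<oplus>\<^bsub>M\<^esub> y) = f x \<oplus>\<^bsub>N\<^esub> f y) \<and>
     (\<forall>a. \<forall>x\<in>carrier M. f (a \<odot>\<^bsub>M\<^esub> x) = a \<odot>\<^bsub>N\<^esub> f x)}"

definition module_epis :: "('a::ring_1, 'm) module \<Rightarrow> ('a, 'n) module \<Rightarrow> ('m \<Rightarrow> 'n) set" where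
  "module_epis M N = {f \<in> module_homs M N. f ` carrier M = carrier N}"

definition module_isomorphic :: "('a::ring_1, 'm) module \<Rightarrow> ('a, 'n) module \<Rightarrow> bool"
    (infix \<open>\<cong>\<^sub>m\<close> 50) where
  "M \<cong>\<^sub>m N \<longleftrightarrow> left_module M \<and> left_module N \<and>
     (\<exists>f\<in>module_homs M N. bij_betw f (carrier M) (carrier N))"

definition left_ideal_module :: "'a::ring_1 set \<Rightarrow> ('a, 'a) module" where
  "left_ideal_module I = \<lparr>carrier = I, mult = undefined, one = undefined,
     zero = 0, add = (+), smult = (*)\<rparr>"

definition direct_power :: "('a::ring_1, 'm) module \<Rightarrow> nat \<Rightarrow> ('a, nat \<Rightarrow> 'm) module" where
  "direct_power M d = \<lparr>carrier = {..<d} \<rightarrow>\<^sub>E carrier M, mult = undefined, one = undefined,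
     zero = (\<lambda>i\<in>{..<d}. \<zero>\<^bsub>M\<^esub>), add = (\<lambda>x y. \<lambda>i\<in>{..<d}. x i \<oplus>\<^bsub>M\<^esub> y i),
     smult = (\<lambda>a x. \<lambda>i\<in>{..<d}. a \<odot>\<^bsub>M\<^esub> x i)\<rparr>"

text \<open>In the scalar multiplication below, all the cosets in the union coincide.\<close>

definition quotient_module :: "('a::ring_1, 'm) module \<Rightarrow> 'm set \<Rightarrow> ('a, 'm set) module" where
  "quotient_module M S = \<lparr>carrier = a_rcosets\<^bsub>M\<^esub> S, mult = undefined, one = undefined,
     zero = S, add = (\<lambda>C D. C <+>\<^bsub>M\<^esub> D),
     smult = (\<lambda>a C. \<Union>x\<in>C. S +>\<^bsub>M\<^esub> (a \<odot>\<^bsub>M\<^esub> x))\<rparr>"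

definition cokernel ::
    "('a::ring_1, 'm) module \<Rightarrow> ('a, 'n) module \<Rightarrow> ('m \<Rightarrow> 'n) \<Rightarrow> ('a, 'n set) module" where
  "cokernel M N f = quotient_module N (f ` carrier M)"


section \<open>The path algebra of the Kronecker quiver\<close>

text \<open>
  The arrows are indexed by a finite type \<open>'r\<close>, so that \<open>r = CARD('r)\<close>.  The paths are the two
  stationary ones and the arrows, which all go from vertex 1 to vertex 2.  In \<open>path_comp p q\<close>
  the path \<open>q\<close> is travelled first, so that \<open>e\<^sub>2 \<gamma>\<^sub>i e\<^sub>1 = \<gamma>\<^sub>i\<close>.
\<close>

datatype vertex = V1 | V2

datatype 'r kpath = Stationary vertex | Arrow 'r

fun source :: "'r kpath \<Rightarrow> vertex" where
  "source (Stationary v) = v"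
| "source (Arrow i) = V1"

fun target :: "'r kpath \<Rightarrow> vertex" where
  "target (Stationary v) = v"
| "target (Arrow i) = V2"

fun path_comp :: "'r kpath \<Rightarrow> 'r kpath \<Rightarrow> 'r kpath option" where
  "path_comp (Stationary v) q = (if target q = v then Some q else None)"
| "path_comp p (Stationary v) = (if source p = v then Some p else None)"
| "path_comp (Arrow i) (Arrow j) = None"

lemma UNIV_kpath: "(UNIV :: 'r kpath set) = {Stationary V1, Stationary V2} \<union> range Arrow"
proof -
  have "p \<in> {Stationary V1, Stationary V2} \<union> range Arrow" for p :: "'r kpath"
  proof (cases p)
    case (Stationary v)
    then show ?thesis by (cases v) auto
  qed auto
  then show ?thesis by auto
qed

instance kpath :: (finite) finite
  by standard (simp add: UNIV_kpath)

typedef ('k, 'r) kronecker = "UNIV :: ('r kpath \<Rightarrow> 'k) set"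
  morphisms coeff_at Kronecker by simp

setup_lifting type_definition_kronecker

lemma kronecker_eqI: "(\<And>p. coeff_at a p = coeff_at b p) \<Longrightarrow> a = b"
  by (metis coeff_at_inject ext)

instantiation kronecker :: (field, finite) ring_1
begin

lift_definition zero_kronecker :: "('a, 'b) kronecker" is "\<lambda>_. 0" .
lift_definition one_kronecker :: "('a, 'b) kronecker" is
  "\<lambda>p. if p \<in> range Stationary then 1 else 0" .
lift_definition plus_kronecker :: "('a, 'b) kronecker \<Rightarrow> ('a, 'b) kronecker \<Rightarrow> ('a, 'b) kronecker"
  is "\<lambda>a b p. a p + b p" .
lift_definition minus_kronecker :: "('a, 'b) kronecker \<Rightarrow> ('a, 'b) kronecker \<Rightarrow> ('a, 'b) kronecker"
  is "\<lambda>a b p. a p - b p" .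
lift_definition uminus_kronecker :: "('a, 'b) kronecker \<Rightarrow> ('a, 'b) kronecker"
  is "\<lambda>a p. - a p" .
lift_definition times_kronecker :: "('a, 'b) kronecker \<Rightarrow> ('a, 'b) kronecker \<Rightarrow> ('a, 'b) kronecker"
  is "\<lambda>a b p. \<Sum>(q, s) | path_comp q s = Some p. a q * b s" .

lemma coeff_at_times_Stationary:
  fixes a b :: "('a, 'b) kronecker"
  shows "coeff_at (a * b) (Stationary v) = coeff_at a (Stationary v) * coeff_at b (Stationary v)"
proof -
  have "path_comp q s = Some (Stationary v) \<longleftrightarrow> q = Stationary v \<and> s = Stationary v"
    for q s :: "'b kpath"
    by (cases q; cases s) auto
  then have "{(q, s). path_comp q s = Some (Stationary v :: 'b kpath)}
      = {(Stationary v, Stationary v)}"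
    by auto
  then show ?thesis by (simp add: times_kronecker.rep_eq)
qed

lemma coeff_at_times_Arrow:
  fixes a b :: "('a, 'b) kronecker"
  shows "coeff_at (a * b) (Arrow i) =
    coeff_at a (Stationary V2) * coeff_at b (Arrow i) +
    coeff_at a (Arrow i) * coeff_at b (Stationary V1)"
proof -
  have "path_comp q s = Some (Arrow i) \<longleftrightarrow>
      (q = Stationary V2 \<and> s = Arrow i) \<or> (q = Arrow i \<and> s = Stationary V1)"
    for q s :: "'b kpath"
    by (cases q; cases s) auto
  then have "{(q, s). path_comp q s = Some (Arrow i :: 'b kpath)}
      = {(Stationary V2, Arrow i), (Arrow i, Stationary V1)}"
    by auto
  then show ?thesis by (simp add: times_kronecker.rep_eq)
qed

lemmas coeff_at_simps =
  coeff_at_times_Stationary coeff_at_times_Arrow zero_kronecker.rep_eq one_kronecker.rep_eq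
  plus_kronecker.rep_eq minus_kronecker.rep_eq uminus_kronecker.rep_eq

instance
proof
  fix a b c :: "('a, 'b) kronecker"
  show "a * b * c = a * (b * c)"
  proof (rule kronecker_eqI)
    show "coeff_at (a * b * c) p = coeff_at (a * (b * c)) p" for p
      by (cases p) (simp_all add: coeff_at_simps algebra_simps)
  qed
  show "1 * a = a"
  proof (rule kronecker_eqI)
    show "coeff_at (1 * a) p = coeff_at a p" for p
      by (cases p) (auto simp: coeff_at_simps)
  qed
  show "a * 1 = a"
  proof (rule kronecker_eqI)
    show "coeff_at (a * 1) p = coeff_at a p" for p
      by (cases p) (auto simp: coeff_at_simps)
  qed
  show "(a + b) * c = a * c + b * c"
  proof (rule kronecker_eqI)
    show "coeff_at ((a + b) * c) p = coeff_at (a * c + b * c) p" for p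
      by (cases p) (simp_all add: coeff_at_simps algebra_simps)
  qed
  show "a * (b + c) = a * b + a * c"
  proof (rule kronecker_eqI)
    show "coeff_at (a * (b + c)) p = coeff_at (a * b + a * c) p" for p
      by (cases p) (simp_all add: coeff_at_simps algebra_simps)
  qed
  have "coeff_at (0 :: ('a, 'b) kronecker) (Stationary V1) \<noteq> coeff_at 1 (Stationary V1)"
    by (simp add: coeff_at_simps)
  then show "(0 :: ('a, 'b) kronecker) \<noteq> 1" by metis
qed (auto intro!: kronecker_eqI simp: coeff_at_simps)

end

definition path_elem :: "'r kpath \<Rightarrow> ('k::field, 'r::finite) kronecker" where
  "path_elem p = Kronecker (\<lambda>q. if q = p then 1 else 0)"

abbreviation e1 :: "('k::field, 'r::finite) kronecker" where
  "e1 \<equiv> path_elem (Stationary V1)"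

abbreviation e2 :: "('k::field, 'r::finite) kronecker" where
  "e2 \<equiv> path_elem (Stationary V2)"

definition scalar :: "'k \<Rightarrow> ('k::field, 'r::finite) kronecker" where
  "scalar c = Kronecker (\<lambda>p. c * coeff_at 1 p)"

definition x_elem :: "'k ^ 'r \<Rightarrow> ('k::field, 'r::finite) kronecker" where
  "x_elem \<alpha> = (\<Sum>i\<in>UNIV. scalar (\<alpha> $ i) * path_elem (Arrow i))"


section \<open>Finite-dimensional modules and dimension vectors\<close>

text \<open>
  A module is a vector space over \<open>'k\<close> through \<^const>\<open>scalar\<close>.  The predicate \<open>has_kdim M V n\<close> says
  that the subspace \<open>V\<close> of \<open>M\<close> has a basis with \<open>n\<close> elements.
\<close>

definition kbasis :: "(('k::field, 'r::finite) kronecker, 'm) module \<Rightarrow> 'm set \<Rightarrow> 'm set \<Rightarrow> bool" where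
  "kbasis M V B \<longleftrightarrow> finite B \<and> B \<subseteq> V \<and>
     (\<forall>v\<in>V. \<exists>!c. c \<in> B \<rightarrow>\<^sub>E UNIV \<and> v = finsum M (\<lambda>b. scalar (c b) \<odot>\<^bsub>M\<^esub> b) B)"

definition has_kdim :: "(('k::field, 'r::finite) kronecker, 'm) module \<Rightarrow> 'm set \<Rightarrow> nat \<Rightarrow> bool" where
  "has_kdim M V n \<longleftrightarrow> (\<exists>B. kbasis M V B \<and> card B = n)"

definition fd_module :: "(('k::field, 'r::finite) kronecker, 'm) module \<Rightarrow> bool" where
  "fd_module M \<longleftrightarrow> left_module M \<and> (\<exists>n. has_kdim M (carrier M) n)"

definition has_dimension_vector ::
    "(('k::field, 'r::finite) kronecker, 'm) module \<Rightarrow> nat \<times> nat \<Rightarrow> bool" where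
  "has_dimension_vector M v \<longleftrightarrow>
     has_kdim M ((\<lambda>m. e1 \<odot>\<^bsub>M\<^esub> m) ` carrier M) (fst v) \<and>
     has_kdim M ((\<lambda>m. e2 \<odot>\<^bsub>M\<^esub> m) ` carrier M) (snd v)"

definition indecomposable :: "(('k::field, 'r::finite) kronecker, 'm) module \<Rightarrow> bool" where
  "indecomposable M \<longleftrightarrow> fd_module M \<and> carrier M \<noteq> {\<zero>\<^bsub>M\<^esub>} \<and>
     (\<forall>A B. submodule_of A M \<and> submodule_of B M \<and>
        A <+>\<^bsub>M\<^esub> B = carrier M \<and> A \<inter> B = {\<zero>\<^bsub>M\<^esub>}
        \<longrightarrow> A = {\<zero>\<^bsub>M\<^esub>} \<or> B = {\<zero>\<^bsub>M\<^esub>})"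


section \<open>Isomorphism classes\<close>

text \<open>
  Isomorphism classes are formed among the modules whose elements have type \<^typ>\<open>nat \<Rightarrow> 'k\<close>.  This
  loses nothing: a module of dimension \<open>n\<close> over \<open>'k\<close> can be transported along a linear bijection
  to the functions vanishing outside \<^term>\<open>{..<n}\<close>.  The class of a finite-dimensional module of
  any type is therefore non-empty, and two such modules have the same class exactly if they are
  isomorphic.
\<close>

type_synonym ('k, 'r) std_module = "(('k, 'r) kronecker, nat \<Rightarrow> 'k) module"

definition iso_class ::
    "(('k::field, 'r::finite) kronecker, 'm) module \<Rightarrow> ('k, 'r) std_module set" where
  "iso_class M = {N. fd_module N \<and> M \<cong>\<^sub>m N}"

definition Q_classes :: "nat \<Rightarrow> ('k::field, 'r::finite) std_module set set" where
  "Q_classes d = iso_class ` {N :: ('k, 'r) std_module.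
     indecomposable N \<and> has_dimension_vector N (1, CARD('r) - d)}"


section \<open>Subspaces and the modules attached to them\<close>

definition Gr :: "nat \<Rightarrow> ('k::field ^ 'r::finite) set set" where
  "Gr d = {U. vec.subspace U \<and> vec.dim U = d}"

definition P1 :: "(('k::field, 'r::finite) kronecker, ('k, 'r) kronecker) module" where
  "P1 = left_ideal_module (range (\<lambda>a. a * e2))"

definition P2 :: "(('k::field, 'r::finite) kronecker, ('k, 'r) kronecker) module" where
  "P2 = left_ideal_module (range (\<lambda>a. a * e1))"

text \<open>
  The homomorphism from the \<open>d\<close>-th power of \<^const>\<open>P1\<close> to \<^const>\<open>P2\<close> that sends \<^const>\<open>e2\<close> in the
  \<open>i\<close>-th coordinate to \<open>x_elem (u i)\<close>; note that \<open>a = a * e2\<close> for all \<open>a\<close> in \<^const>\<open>P1\<close>.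
\<close>

definition presentation_hom ::
    "nat \<Rightarrow> (nat \<Rightarrow> 'k ^ 'r) \<Rightarrow> (nat \<Rightarrow> ('k::field, 'r::finite) kronecker) \<Rightarrow> ('k, 'r) kronecker" where
  "presentation_hom d u a = (\<Sum>i<d. a i * x_elem (u i))"

definition basis_tuple :: "('k::field ^ 'r::finite) set \<Rightarrow> (nat \<Rightarrow> 'k ^ 'r) \<Rightarrow> bool" where
  "basis_tuple U u \<longleftrightarrow> inj_on u {..<vec.dim U} \<and> vec.independent (u ` {..<vec.dim U}) \<and>
     vec.span (u ` {..<vec.dim U}) = U"

definition X_of_tuple ::
    "nat \<Rightarrow> (nat \<Rightarrow> 'k ^ 'r) \<Rightarrow>
     (('k::field, 'r::finite) kronecker, ('k, 'r) kronecker set) module" where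
  "X_of_tuple d u = cokernel (direct_power P1 d) P2 (presentation_hom d u)"

definition X_mod ::
    "('k ^ 'r) set \<Rightarrow> (('k::field, 'r::finite) kronecker, ('k, 'r) kronecker set) module" where
  "X_mod U = X_of_tuple (vec.dim U) (SOME u. basis_tuple U u)"

lemma coeff_at_sum: "coeff_at (\<Sum>i\<in>A. f i) p = (\<Sum>i\<in>A. coeff_at (f i) p)"
  for f :: "'i \<Rightarrow> ('k::field, 'r::finite) kronecker"
  by (induction A rule: infinite_finite_induct) (simp_all add: coeff_at_simps)

lemma coeff_at_path_elem: "coeff_at (path_elem p) q = (if q = p then 1 else 0)"
  by (simp add: path_elem_def Kronecker_inverse)

lemma coeff_at_scalar: "coeff_at (scalar c) q = (if q \<in> range Stationary then c else 0)"
  by (simp add: scalar_def Kronecker_inverse one_kronecker.rep_eq)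

lemma coeff_at_x_elem:
  "coeff_at (x_elem \<alpha>) q = (case q of Stationary v \<Rightarrow> 0 | Arrow i \<Rightarrow> \<alpha> $ i)"
proof (cases q)
  case (Arrow j)
  have "coeff_at (x_elem \<alpha>) q = (\<Sum>i\<in>UNIV. if i = j then \<alpha> $ i else 0)"
    unfolding x_elem_def coeff_at_sum Arrow
    by (rule sum.cong) (auto simp: coeff_at_times_Arrow coeff_at_path_elem coeff_at_scalar)
  then show ?thesis using Arrow by simp
qed (simp add: x_elem_def coeff_at_sum coeff_at_times_Stationary coeff_at_path_elem)

lemma presentation_hom_eq:
  "presentation_hom d u a = x_elem (\<Sum>i<d. coeff_at (a i) (Stationary V2) *s u i)"
proof (rule kronecker_eqI)
  show "coeff_at (presentation_hom d u a) p =
      coeff_at (x_elem (\<Sum>i<d. coeff_at (a i) (Stationary V2) *s u i)) p" for p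
    by (cases p) (simp_all add: presentation_hom_def coeff_at_sum coeff_at_x_elem
        coeff_at_times_Stationary coeff_at_times_Arrow)
qed

lemma presentation_hom_image:
  "presentation_hom d u ` carrier (direct_power P1 d) = x_elem ` vec.span (u ` {..<d})"
proof (intro equalityI subsetI)
  fix y assume "y \<in> presentation_hom d u ` carrier (direct_power P1 d)"
  then obtain a where "y = presentation_hom d u a" by auto
  moreover have "(\<Sum>i<d. coeff_at (a i) (Stationary V2) *s u i) \<in> vec.span (u ` {..<d})"
    by (intro vec.span_sum vec.span_scale vec.span_base) auto
  ultimately show "y \<in> x_elem ` vec.span (u ` {..<d})"
    by (simp add: presentation_hom_eq)
next
  fix y assume "y \<in> x_elem ` vec.span (u ` {..<d})"
  then obtain v where v: "v \<in> vec.span (u ` {..<d})" and y: "y = x_elem v" by auto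
  have "\<exists>c. v = (\<Sum>i<d. c i *s u i)"
    using v
  proof (induction rule: vec.span_induct_alt)
    case base
    show ?case by (rule exI[of _ "\<lambda>_. 0"]) simp
  next
    case (step c x y)
    then obtain j b where j: "j < d" "x = u j" and b: "y = (\<Sum>i<d. b i *s u i)" by auto
    have "c *s x = (\<Sum>i<d. (if i = j then c else 0) *s u i)"
      using j by (simp add: if_distrib [of "\<lambda>t. t *s _"] sum.delta cong: if_cong)
    then have "c *s x + y = (\<Sum>i<d. ((if i = j then c else 0) + b i) *s u i)"
      using b by (simp add: vec.scale_left_distrib sum.distrib)
    then show ?case by (rule exI[of _ "\<lambda>i. (if i = j then c else 0) + b i"])
  qed
  then obtain c where c: "v = (\<Sum>i<d. c i *s u i)" ..
  define a :: "nat \<Rightarrow> ('a, 'b) kronecker" where "a = (\<lambda>i\<in>{..<d}. scalar (c i) * e2)"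
  have "a \<in> carrier (direct_power P1 d)"
    by (auto simp: a_def direct_power_def P1_def left_ideal_module_def)
  moreover have "presentation_hom d u a = y"
    by (simp add: presentation_hom_eq y c a_def coeff_at_times_Stationary coeff_at_scalar
        coeff_at_path_elem)
  ultimately show "y \<in> presentation_hom d u ` carrier (direct_power P1 d)" by blast
qed

lemma basis_tuple_exists: "\<exists>u. basis_tuple U u" if "vec.subspace U"
proof -
  obtain B where B: "B \<subseteq> U" "vec.independent B" "U \<subseteq> vec.span B" "card B = vec.dim U"
    by (rule vec.basis_exists)
  have "finite B" using B(2) by (rule vec.finiteI_independent)
  then obtain u where "bij_betw u {..<vec.dim U} B"
    using B(4) by (metis bij_betw_from_nat_into_finite)
  moreover have "vec.span B = U"
    using B that by (metis vec.span_minimal subset_antisym)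
  ultimately show ?thesis
    using B(2) by (auto simp: basis_tuple_def bij_betw_def)
qed

text \<open>The choice of a basis in the definition of \<open>X_mod\<close> is immaterial.\<close>

lemma X_mod_eq: "X_mod U = X_of_tuple (vec.dim U) u" if "basis_tuple U u"
proof -
  have "basis_tuple U (SOME u. basis_tuple U u)" 
    using that by (rule someI[of "basis_tuple U"])
  then show ?thesis
    using that by (simp add: X_mod_def X_of_tuple_def cokernel_def presentation_hom_image
        basis_tuple_def)
qed

end

theory Submission
  imports Defs
begin

text \<open>
  Let \<open>M\<close> be indecomposable with \<open>dim e\<^sub>1M = 1\<close>, and let \<open>m\<close> span \<open>e\<^sub>1M\<close>.  A vector space
  complement of \<open>\<K>m \<inter> e\<^sub>2M\<close> in \<open>e\<^sub>2M\<close> is a submodule complementing \<open>\<K>m\<close>, so \<open>M = \<K>m\<close>.  Hence \<open>M\<close> is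
  determined by the subspace \<open>U = {\<alpha>. x\<^sub>\<alpha> m = 0}\<close>, which does not depend on \<open>m\<close> because \<open>m\<close> is
  unique up to a scalar: \<open>M \<cong> X\<^sub>U\<close>, and \<open>dim e\<^sub>2M = r - dim U\<close>.  Conversely \<open>X\<^sub>U\<close> is
  indecomposable, since in any decomposition one of the two summands contains the
  one-dimensional space \<open>e\<^sub>1X\<^sub>U\<close>, which generates.  For the last part, an inclusion
  \<open>V \<subseteq> U\<close> induces an epimorphism \<open>X\<^sub>V \<rightarrow> X\<^sub>U\<close>.
\<close>

section \<open>Modules, homomorphisms and quotients\<close>

context left_module
begin

lemma smult_zero_right [simp]: "a \<odot>\<^bsub>M\<^esub> \<zero>\<^bsub>M\<^esub> = \<zero>\<^bsub>M\<^esub>"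
proof -
  have "a \<odot>\<^bsub>M\<^esub> \<zero>\<^bsub>M\<^esub> \<oplus>\<^bsub>M\<^esub> a \<odot>\<^bsub>M\<^esub> \<zero>\<^bsub>M\<^esub> = a \<odot>\<^bsub>M\<^esub> \<zero>\<^bsub>M\<^esub> \<oplus>\<^bsub>M\<^esub> \<zero>\<^bsub>M\<^esub>"
    using smult_r_distr[of "\<zero>\<^bsub>M\<^esub>" "\<zero>\<^bsub>M\<^esub>" a] smult_closed[of "\<zero>\<^bsub>M\<^esub>" a] by simp
  then show ?thesis
    using smult_closed[of "\<zero>\<^bsub>M\<^esub>" a] by simp
qed

lemma smult_zero_left [simp]:
  assumes "x \<in> carrier M"
  shows "0 \<odot>\<^bsub>M\<^esub> x = \<zero>\<^bsub>M\<^esub>"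
proof -
  have "0 \<odot>\<^bsub>M\<^esub> x \<oplus>\<^bsub>M\<^esub> 0 \<odot>\<^bsub>M\<^esub> x = 0 \<odot>\<^bsub>M\<^esub> x \<oplus>\<^bsub>M\<^esub> \<zero>\<^bsub>M\<^esub>"
    using smult_l_distr[OF assms, of 0 0] smult_closed[OF assms, of 0] by simp
  then show ?thesis
    using smult_closed[OF assms, of 0] by simp
qed

lemma smult_minus_left:
  assumes "x \<in> carrier M"
  shows "(- a) \<odot>\<^bsub>M\<^esub> x = \<ominus>\<^bsub>M\<^esub> (a \<odot>\<^bsub>M\<^esub> x)"
proof -
  have "(- a) \<odot>\<^bsub>M\<^esub> x \<oplus>\<^bsub>M\<^esub> a \<odot>\<^bsub>M\<^esub> x = \<zero>\<^bsub>M\<^esub>"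
    using smult_l_distr[OF assms, of "- a" a] assms by simp
  then show ?thesis
    using assms by (simp add: smult_closed minus_equality)
qed

lemma smult_diff_eq_zero_iff:
  assumes "x \<in> carrier M"
  shows "(a - b) \<odot>\<^bsub>M\<^esub> x = \<zero>\<^bsub>M\<^esub> \<longleftrightarrow> a \<odot>\<^bsub>M\<^esub> x = b \<odot>\<^bsub>M\<^esub> x"
proof -
  have "a \<odot>\<^bsub>M\<^esub> x = (a - b) \<odot>\<^bsub>M\<^esub> x \<oplus>\<^bsub>M\<^esub> b \<odot>\<^bsub>M\<^esub> x"
    using smult_l_distr[OF assms, of "a - b" b] by simp
  then show ?thesis
    using assms by (simp add: smult_closed)
qed

text \<open>Closure under negation is not part of \<open>submodule_of\<close>; it comes from
  multiplication by -1. It is what makes submodules additive subgroups, so that the coset theory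
  applies.\<close>

lemma submodule_minus_closed:
  assumes "submodule_of S M" "x \<in> S"
  shows "\<ominus>\<^bsub>M\<^esub> x \<in> S"
proof -
  have "x \<in> carrier M"
    using assms by (auto simp: submodule_of_def)
  then have "\<ominus>\<^bsub>M\<^esub> x = (- 1) \<odot>\<^bsub>M\<^esub> x"
    by (simp add: smult_minus_left smult_one)
  then show ?thesis
    using assms by (auto simp: submodule_of_def)
qed

lemma submodule_abelian_subgroup:
  assumes "submodule_of S M"
  shows "abelian_subgroup S M"
proof (rule abelian_subgroupI3)
  show "additive_subgroup S M"
    using assms submodule_minus_closed[OF assms]
    by unfold_locales (auto simp: submodule_of_def a_inv_def)
qed (rule abelian_group_axioms)

lemma submodule_cyclic:
  assumes "x \<in> carrier M"
  shows "submodule_of (range (\<lambda>a. a \<odot>\<^bsub>M\<^esub> x)) M"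
  unfolding submodule_of_def
  using assms smult_zero_left[OF assms]
  by (auto simp: smult_closed image_iff simp flip: smult_l_distr smult_assoc) (metis smult_zero_left)

end

section \<open>Homomorphisms and isomorphisms\<close>

lemma module_homsI:
  assumes "\<And>x. x \<in> carrier M \<Longrightarrow> f x \<in> carrier N"
    and "\<And>x y. x \<in> carrier M \<Longrightarrow> y \<in> carrier M \<Longrightarrow> f (x \<oplus>\<^bsub>M\<^esub> y) = f x \<oplus>\<^bsub>N\<^esub> f y"
    and "\<And>a x. x \<in> carrier M \<Longrightarrow> f (a \<odot>\<^bsub>M\<^esub> x) = a \<odot>\<^bsub>N\<^esub> f x"
  shows "f \<in> module_homs M N"
  using assms by (auto simp: module_homs_def)

lemma module_homsD:
  assumes "f \<in> module_homs M N"
  shows "x \<in> carrier M \<Longrightarrow> f x \<in> carrier N"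
    and "x \<in> carrier M \<Longrightarrow> y \<in> carrier M \<Longrightarrow> f (x \<oplus>\<^bsub>M\<^esub> y) = f x \<oplus>\<^bsub>N\<^esub> f y"
    and "x \<in> carrier M \<Longrightarrow> f (a \<odot>\<^bsub>M\<^esub> x) = a \<odot>\<^bsub>N\<^esub> f x"
  using assms by (auto simp: module_homs_def)

lemma module_hom_zero:
  assumes "left_module M" "left_module N" "f \<in> module_homs M N"
  shows "f \<zero>\<^bsub>M\<^esub> = \<zero>\<^bsub>N\<^esub>"
proof -
  interpret M: left_module M by fact
  interpret N: left_module N by fact
  have "f (0 \<odot>\<^bsub>M\<^esub> \<zero>\<^bsub>M\<^esub>) = 0 \<odot>\<^bsub>N\<^esub> f \<zero>\<^bsub>M\<^esub>"
    using module_homsD[OF assms(3)] by blast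
  then show ?thesis
    using module_homsD(1)[OF assms(3)] by simp
qed

lemma module_isomorphic_sym:
  assumes "M \<cong>\<^sub>m N"
  shows "N \<cong>\<^sub>m M"
proof -
  obtain f where f: "f \<in> module_homs M N" "bij_betw f (carrier M) (carrier N)"
    and M: "left_module M" and N: "left_module N"
    using assms by (auto simp: module_isomorphic_def)
  interpret M: left_module M by fact
  define h where "h = inv_into (carrier M) f"
  have h: "h y \<in> carrier M" "f (h y) = y" if "y \<in> carrier N" for y
    using f(2) that
    by (auto simp: h_def bij_betw_def inv_into_into f_inv_into_f)
  have hf: "h (f x) = x" if "x \<in> carrier M" for x
    using f(2) that by (auto simp: h_def bij_betw_def)
  have "h \<in> module_homs N M"
  proof (rule module_homsI)
    fix x y assume "x \<in> carrier N" "y \<in> carrier N"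
    then have "x \<oplus>\<^bsub>N\<^esub> y = f (h x \<oplus>\<^bsub>M\<^esub> h y)"
      by (simp add: h module_homsD(2)[OF f(1)])
    then show "h (x \<oplus>\<^bsub>N\<^esub> y) = h x \<oplus>\<^bsub>M\<^esub> h y"
      using \<open>x \<in> carrier N\<close> \<open>y \<in> carrier N\<close> by (simp add: hf h)
  next
    fix a x assume "x \<in> carrier N"
    then have "a \<odot>\<^bsub>N\<^esub> x = f (a \<odot>\<^bsub>M\<^esub> h x)"
      by (simp add: h module_homsD(3)[OF f(1)])
    then show "h (a \<odot>\<^bsub>N\<^esub> x) = a \<odot>\<^bsub>M\<^esub> h x"
      using \<open>x \<in> carrier N\<close> by (simp add: hf h M.smult_closed)
  qed (simp add: h)
  moreover have "bij_betw h (carrier N) (carrier M)"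
    using f(2) by (auto simp: h_def bij_betw_inv_into)
  ultimately show ?thesis
    using M N by (auto simp: module_isomorphic_def)
qed

lemma module_isomorphic_trans:
  assumes "M \<cong>\<^sub>m N" "N \<cong>\<^sub>m L"
  shows "M \<cong>\<^sub>m L"
proof -
  obtain f g where f: "f \<in> module_homs M N" "bij_betw f (carrier M) (carrier N)"
    and g: "g \<in> module_homs N L" "bij_betw g (carrier N) (carrier L)"
    using assms by (auto simp: module_isomorphic_def)
  have "g \<circ> f \<in> module_homs M L"
    using module_homsD[OF f(1)] module_homsD[OF g(1)] by (auto intro!: module_homsI)
  then show ?thesis
    using assms bij_betw_trans[OF f(2) g(2)] by (auto simp: module_isomorphic_def)
qed

text \<open>Each module axiom is an identity or an existence claim that \<open>f\<close> carries
  over from \<open>M\<close>. This spares a separate check of the axioms for quotients and for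
  transported structures.\<close>

lemma left_module_surj_image:
  assumes "left_module M" and surj: "f ` carrier M = carrier N"
    and add: "\<And>x y. x \<in> carrier M \<Longrightarrow> y \<in> carrier M \<Longrightarrow> f (x \<oplus>\<^bsub>M\<^esub> y) = f x \<oplus>\<^bsub>N\<^esub> f y"
    and smult: "\<And>a x. x \<in> carrier M \<Longrightarrow> f (a \<odot>\<^bsub>M\<^esub> x) = a \<odot>\<^bsub>N\<^esub> f x"
    and zero: "f \<zero>\<^bsub>M\<^esub> = \<zero>\<^bsub>N\<^esub>"
  shows "left_module N"
proof -
  interpret M: left_module M by fact
  have lift: "\<exists>x\<in>carrier M. y = f x" if "y \<in> carrier N" for y
    using that surj by auto
  have closed: "f x \<in> carrier N" if "x \<in> carrier M" for x
    using that surj by auto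
  show ?thesis
  proof (intro left_module.intro left_module_axioms.intro abelian_groupI)
    fix x y assume "x \<in> carrier N" "y \<in> carrier N"
    then show "x \<oplus>\<^bsub>N\<^esub> y \<in> carrier N"
      by (auto dest!: lift simp: closed simp flip: add)
  next
    show "\<zero>\<^bsub>N\<^esub> \<in> carrier N"
      using closed[OF M.zero_closed] by (simp add: zero)
  next
    fix x y z assume "x \<in> carrier N" "y \<in> carrier N" "z \<in> carrier N"
    then show "x \<oplus>\<^bsub>N\<^esub> y \<oplus>\<^bsub>N\<^esub> z = x \<oplus>\<^bsub>N\<^esub> (y \<oplus>\<^bsub>N\<^esub> z)"
      by (auto dest!: lift simp: M.a_assoc simp flip: add)
  next
    fix x y assume "x \<in> carrier N" "y \<in> carrier N"
    then show "x \<oplus>\<^bsub>N\<^esub> y = y \<oplus>\<^bsub>N\<^esub> x"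
      by (auto dest!: lift simp: M.a_comm simp flip: add)
  next
    fix x assume "x \<in> carrier N"
    then show "\<zero>\<^bsub>N\<^esub> \<oplus>\<^bsub>N\<^esub> x = x"
      by (auto dest!: lift simp flip: zero add)
  next
    fix x assume "x \<in> carrier N"
    then obtain y where y: "y \<in> carrier M" "x = f y"
      using lift by blast
    then have "f (\<ominus>\<^bsub>M\<^esub> y) \<oplus>\<^bsub>N\<^esub> x = \<zero>\<^bsub>N\<^esub>"
      by (simp add: M.l_neg zero flip: add)
    then show "\<exists>z\<in>carrier N. z \<oplus>\<^bsub>N\<^esub> x = \<zero>\<^bsub>N\<^esub>"
      using y closed by blast
  next
    fix x a assume "x \<in> carrier N"
    then show "a \<odot>\<^bsub>N\<^esub> x \<in> carrier N"
      by (auto dest!: lift simp: closed M.smult_closed simp flip: smult)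
  next
    fix x a b assume "x \<in> carrier N"
    then show "(a + b) \<odot>\<^bsub>N\<^esub> x = a \<odot>\<^bsub>N\<^esub> x \<oplus>\<^bsub>N\<^esub> b \<odot>\<^bsub>N\<^esub> x"
      by (auto dest!: lift simp: M.smult_closed M.smult_l_distr simp flip: smult add)
  next
    fix x y a assume "x \<in> carrier N" "y \<in> carrier N"
    then show "a \<odot>\<^bsub>N\<^esub> (x \<oplus>\<^bsub>N\<^esub> y) = a \<odot>\<^bsub>N\<^esub> x \<oplus>\<^bsub>N\<^esub> a \<odot>\<^bsub>N\<^esub> y"
      by (auto dest!: lift simp: M.smult_closed M.smult_r_distr simp flip: smult add)
  next
    fix x a b assume "x \<in> carrier N"
    then show "(a * b) \<odot>\<^bsub>N\<^esub> x = a \<odot>\<^bsub>N\<^esub> (b \<odot>\<^bsub>N\<^esub> x)"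
      by (auto dest!: lift simp: M.smult_closed M.smult_assoc simp flip: smult)
  next
    fix x assume "x \<in> carrier N"
    then show "1 \<odot>\<^bsub>N\<^esub> x = x"
      by (auto dest!: lift simp: M.smult_one simp flip: smult)
  qed
qed

text \<open>Two elements of one coset differ by some \<open>s\<close> in \<open>S\<close>, their
  multiples by \<open>a\<close> differ by \<open>a\<close> times \<open>s\<close>, which is again in
  \<open>S\<close>. Hence the union defining the scalar multiplication collapses to one
  coset.\<close>

lemma quotient_module_smult:
  assumes "left_module M" "submodule_of S M" "x \<in> carrier M"
  shows "(\<Union>y\<in>S +>\<^bsub>M\<^esub> x. S +>\<^bsub>M\<^esub> (a \<odot>\<^bsub>M\<^esub> y)) = S +>\<^bsub>M\<^esub> (a \<odot>\<^bsub>M\<^esub> x)"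
proof -
  interpret M: left_module M by fact
  interpret S: abelian_subgroup S M by (rule M.submodule_abelian_subgroup) fact
  have "S +>\<^bsub>M\<^esub> (a \<odot>\<^bsub>M\<^esub> y) = S +>\<^bsub>M\<^esub> (a \<odot>\<^bsub>M\<^esub> x)" if y: "y \<in> S +>\<^bsub>M\<^esub> x" for y
  proof -
    obtain s where s: "s \<in> S" "y = s \<oplus>\<^bsub>M\<^esub> x"
      using y unfolding a_r_coset_def' by blast
    then have "a \<odot>\<^bsub>M\<^esub> y = a \<odot>\<^bsub>M\<^esub> s \<oplus>\<^bsub>M\<^esub> a \<odot>\<^bsub>M\<^esub> x" "a \<odot>\<^bsub>M\<^esub> s \<in> S"
      using assms S.a_Hcarr[of s] by (auto simp: submodule_of_def M.smult_r_distr)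
    then have "a \<odot>\<^bsub>M\<^esub> y \<in> S +>\<^bsub>M\<^esub> (a \<odot>\<^bsub>M\<^esub> x)"
      unfolding a_r_coset_def' by auto
    then show ?thesis
      by (rule S.a_repr_independence'[OF _ M.smult_closed[OF assms(3)], symmetric])
  qed
  moreover have "x \<in> S +>\<^bsub>M\<^esub> x"
    using S.a_rcos_self[OF assms(3)] .
  ultimately show ?thesis by blast
qed

lemma quotient_module_projection:
  assumes "left_module M" "submodule_of S M"
  shows "left_module (quotient_module M S)"
    and "(\<lambda>x. S +>\<^bsub>M\<^esub> x) \<in> module_epis M (quotient_module M S)"
    and "x \<in> carrier M \<Longrightarrow> S +>\<^bsub>M\<^esub> x = \<zero>\<^bsub>quotient_module M S\<^esub> \<longleftrightarrow> x \<in> S"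
proof -
  interpret M: left_module M by fact
  interpret S: abelian_subgroup S M by (rule M.submodule_abelian_subgroup) fact
  let ?Q = "quotient_module M S" and ?p = "\<lambda>x. S +>\<^bsub>M\<^esub> x"
  have surj: "?p ` carrier M = carrier ?Q"
    by (auto simp: quotient_module_def A_RCOSETS_def')
  have add: "?p (x \<oplus>\<^bsub>M\<^esub> y) = ?p x \<oplus>\<^bsub>?Q\<^esub> ?p y" if "x \<in> carrier M" "y \<in> carrier M" for x y
    using that by (simp add: quotient_module_def S.a_rcos_sum)
  have smult: "?p (a \<odot>\<^bsub>M\<^esub> x) = a \<odot>\<^bsub>?Q\<^esub> ?p x" if "x \<in> carrier M" for a x
    using quotient_module_smult[OF assms that] by (simp add: quotient_module_def)
  have zero: "?p x = \<zero>\<^bsub>?Q\<^esub> \<longleftrightarrow> x \<in> S" if "x \<in> carrier M" for x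
  proof -
    have "x \<in> S" if "S +>\<^bsub>M\<^esub> x = S"
      using S.a_rcos_self[OF \<open>x \<in> carrier M\<close>] unfolding that .
    then show ?thesis
      using S.a_rcos_const[of x] by (auto simp: quotient_module_def)
  qed
  have "?p \<zero>\<^bsub>M\<^esub> = \<zero>\<^bsub>?Q\<^esub>"
    using zero[OF M.zero_closed] assms(2) unfolding submodule_of_def by blast
  from left_module_surj_image[OF assms(1) surj add smult this] show "left_module ?Q" .
  show "?p \<in> module_epis M ?Q"
    using surj add smult by (auto simp: module_epis_def intro!: module_homsI)
  show "x \<in> carrier M \<Longrightarrow> ?p x = \<zero>\<^bsub>?Q\<^esub> \<longleftrightarrow> x \<in> S"
    by (rule zero)
qed

text \<open>The operations are conjugated by \<open>f\<close> onto its image. The purpose is to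
  replace a module by an isomorphic one whose elements have a prescribed type.\<close>

lemma transport_module:
  fixes M :: "('a::ring_1, 'm) module" and f :: "'m \<Rightarrow> 'n"
  assumes "left_module M" "inj_on f (carrier M)"
  shows "\<exists>N :: ('a, 'n) module. M \<cong>\<^sub>m N"
proof -
  interpret M: left_module M by fact
  let ?h = "inv_into (carrier M) f"
  define N :: "('a, 'n) module" where
    "N = \<lparr>carrier = f ` carrier M, mult = undefined, one = undefined, zero = f \<zero>\<^bsub>M\<^esub>,
      add = (\<lambda>x y. f (?h x \<oplus>\<^bsub>M\<^esub> ?h y)), smult = (\<lambda>a x. f (a \<odot>\<^bsub>M\<^esub> ?h x))\<rparr>"
  have add: "f (x \<oplus>\<^bsub>M\<^esub> y) = f x \<oplus>\<^bsub>N\<^esub> f y" if "x \<in> carrier M" "y \<in> carrier M" for x y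
    using that assms(2) by (simp add: N_def)
  have smult: "f (a \<odot>\<^bsub>M\<^esub> x) = a \<odot>\<^bsub>N\<^esub> f x" if "x \<in> carrier M" for a x
    using that assms(2) by (simp add: N_def)
  have "left_module N"
    by (rule left_module_surj_image[OF assms(1) _ add smult]) (simp_all add: N_def)
  moreover have "f \<in> module_homs M N"
    using add smult by (intro module_homsI) (auto simp: N_def)
  moreover have "bij_betw f (carrier M) (carrier N)"
    using assms(2) by (simp add: bij_betw_def N_def)
  ultimately show ?thesis
    using assms(1) by (auto simp: module_isomorphic_def)
qed

section \<open>Dimensions of images of linear maps\<close>

text \<open>
  The vector space structure of a module lives on its carrier only, so the theory of bases in
  the library does not apply to it.  Dimensions of subspaces are instead computed by presenting
  them as images of linear maps from coordinate spaces, where that theory is available.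
\<close>

locale linear_into_module = left_module M
  for M :: "(('k::field, 'r::finite) kronecker, 'm) module" +
  fixes g :: "'k ^ 's::finite \<Rightarrow> 'm"
  assumes g_closed: "g v \<in> carrier M"
    and g_add: "g (v + w) = g v \<oplus>\<^bsub>M\<^esub> g w"
    and g_scale: "g (c *s v) = scalar c \<odot>\<^bsub>M\<^esub> g v"
begin

definition ker :: "('k ^ 's) set" where "ker = {v. g v = \<zero>\<^bsub>M\<^esub>}"

lemma g_zero: "g 0 = \<zero>\<^bsub>M\<^esub>"
  using g_add[of 0 0] g_closed[of 0] by simp

lemma g_diff_in_ker: "v - w \<in> ker \<longleftrightarrow> g v = g w"
proof -
  have "g v = g (v - w) \<oplus>\<^bsub>M\<^esub> g w"
    by (metis diff_add_cancel g_add)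
  then show ?thesis
    using g_closed by (simp add: ker_def)
qed

lemma subspace_ker: "vec.subspace ker"
  by (rule vec.subspaceI) (auto simp: ker_def g_zero g_add g_scale)

lemma g_sum:
  assumes "finite C"
  shows "g (\<Sum>x\<in>C. c x *s x) = finsum M (\<lambda>x. scalar (c x) \<odot>\<^bsub>M\<^esub> g x) C"
  using assms
proof induction
  case (insert x C)
  then show ?case
    by (simp add: g_add g_scale g_closed smult_closed Pi_def)
qed (simp add: g_zero)

text \<open>Linear combinations in \<open>M\<close> become images of vector sums, so questions about
  bases of the image turn into questions about the coordinate space modulo
  \<open>ker\<close>.\<close>

lemma g_sum_image:
  assumes "finite C" "inj_on g C"
  shows "finsum M (\<lambda>b. scalar (c b) \<odot>\<^bsub>M\<^esub> b) (g ` C) = g (\<Sum>x\<in>C. c (g x) *s x)"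
  unfolding g_sum[OF assms(1)]
  by (rule finsum_reindex[OF _ assms(2)]) (auto simp: g_closed smult_closed)

text \<open>The hypotheses say that \<open>vec.span C\<close> is a complement of \<open>ker\<close>.
  On a complement \<open>g\<close> is injective with full image, so it takes the basis
  \<open>C\<close> to a basis. Injectivity on \<open>C\<close> is recorded because the cardinality
  is needed later.\<close>

lemma kbasis_image:
  assumes "finite C" and ind: "vec.independent C"
    and cap: "vec.span C \<inter> ker = {0}" and cover: "\<And>v. \<exists>w\<in>vec.span C. v - w \<in> ker"
  shows "kbasis M (range g) (g ` C) \<and> inj_on g C"
proof -
  have inj_span: "v = w" if "v \<in> vec.span C" "w \<in> vec.span C" "g v = g w" for v w
  proof -
    have "v - w \<in> vec.span C \<inter> ker"
      using that by (simp add: g_diff_in_ker vec.span_diff)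
    then show ?thesis
      using cap by simp
  qed
  then have inj: "inj_on g C"
    by (auto simp: inj_on_def intro: vec.span_base)
  have "\<exists>!c. c \<in> g ` C \<rightarrow>\<^sub>E UNIV \<and> g v = finsum M (\<lambda>b. scalar (c b) \<odot>\<^bsub>M\<^esub> b) (g ` C)" for v
  proof (rule ex_ex1I)
    obtain w where w: "w \<in> vec.span C" "v - w \<in> ker"
      using cover by blast
    then obtain c where c: "w = (\<Sum>x\<in>C. c x *s x)"
      by (auto simp: vec.span_finite[OF assms(1)])
    \<comment> \<open>The coefficients are moved from \<open>C\<close> to its image;
      \<open>restrict\<close> makes them \<open>undefined\<close> elsewhere, as membership in the
      extensional function space demands.\<close>
    define d where "d = restrict (\<lambda>b. c (inv_into C g b)) (g ` C)"
    have "(\<Sum>x\<in>C. d (g x) *s x) = w"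
      unfolding c by (rule sum.cong) (auto simp: d_def inj)
    then have "d \<in> g ` C \<rightarrow>\<^sub>E UNIV \<and> g v = finsum M (\<lambda>b. scalar (d b) \<odot>\<^bsub>M\<^esub> b) (g ` C)"
      using w(2) by (simp add: g_sum_image[OF assms(1) inj] g_diff_in_ker) (simp add: d_def)
    then show "\<exists>c. c \<in> g ` C \<rightarrow>\<^sub>E UNIV \<and>
        g v = finsum M (\<lambda>b. scalar (c b) \<odot>\<^bsub>M\<^esub> b) (g ` C)"
      by blast
  next
    fix c d
    assume c: "c \<in> g ` C \<rightarrow>\<^sub>E UNIV \<and> g v = finsum M (\<lambda>b. scalar (c b) \<odot>\<^bsub>M\<^esub> b) (g ` C)"
      and d: "d \<in> g ` C \<rightarrow>\<^sub>E UNIV \<and> g v = finsum M (\<lambda>b. scalar (d b) \<odot>\<^bsub>M\<^esub> b) (g ` C)"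
    have "(\<Sum>x\<in>C. c (g x) *s x) = (\<Sum>x\<in>C. d (g x) *s x)"
    proof (rule inj_span)
      show "(\<Sum>x\<in>C. c (g x) *s x) \<in> vec.span C" "(\<Sum>x\<in>C. d (g x) *s x) \<in> vec.span C"
        by (simp_all add: vec.span_sum vec.span_scale vec.span_base)
    qed (use c d in \<open>simp add: g_sum_image[OF assms(1) inj]\<close>)
    then have "(\<Sum>x\<in>C. (c (g x) - d (g x)) *s x) = 0"
      by (simp add: vec.scale_left_diff_distrib sum_subtractf)
    then have "c (g x) - d (g x) = 0" if "x \<in> C" for x
      using vec.independentD[OF ind assms(1) subset_refl, of "\<lambda>x. c (g x) - d (g x)" x] that by simp
    then show "c = d"
      using c d by (intro PiE_ext[of c "g ` C" "\<lambda>_. UNIV" d]) auto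
  qed
  then show ?thesis
    using assms(1) inj by (auto simp: kbasis_def)
qed

text \<open>Rank-nullity: a basis \<open>A\<close> of the kernel is extended to a basis of the
  coordinate space, and the added vectors \<open>C\<close> span a complement of the kernel.\<close>

lemma has_kdim_imageI: "has_kdim M (range g) (CARD('s) - vec.dim ker)"
proof -
  obtain A where A: "A \<subseteq> ker" "vec.independent A" "ker \<subseteq> vec.span A" "card A = vec.dim ker"
    by (rule vec.basis_exists)
  let ?B = "vec.extend_basis A"
  define C where "C = ?B - A"
  have B: "A \<subseteq> ?B" "vec.independent ?B" "vec.span ?B = UNIV"
    using A(2) by (auto simp: vec.extend_basis_superset vec.independent_extend_basis)
  have fin: "finite ?B"
    using B(2) by (rule vec.finiteI_independent)
  have "card ?B = CARD('s)"
    using vec.dim_eq_card_independent[OF B(2)] vec.dim_span[of ?B] B(3) by (simp add: card_cart_basis)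
  then have card: "card C = CARD('s) - vec.dim ker"
    using A(4) B(1) fin by (simp add: C_def card_Diff_subset finite_subset)
  have spanA: "vec.span A = ker"
    using A(1,3) subspace_ker by (metis vec.span_minimal subset_antisym)
  have "?B = C \<union> A" "C \<inter> A = {}"
    using B(1) by (auto simp: C_def)
  have "finite A" "finite C"
    using fin B(1) by (auto simp: C_def intro: finite_subset)
  have "vec.span C \<inter> ker = {0}"
  proof -
    have "v = 0" if v: "v \<in> vec.span C" "v \<in> vec.span A" for v
    proof -
      obtain c where c: "v = (\<Sum>x\<in>C. c x *s x)"
        using v(1) unfolding vec.span_finite[OF \<open>finite C\<close>] by blast
      obtain d where d: "v = (\<Sum>x\<in>A. d x *s x)"
        using v(2) unfolding vec.span_finite[OF \<open>finite A\<close>] by blast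
      \<comment> \<open>Subtracting the two expansions of \<open>v\<close> gives a linear relation
        on the whole basis, with coefficients \<open>c\<close> on \<open>C\<close> and
        \<open>- d\<close> on \<open>A\<close>.\<close>
      let ?e = "\<lambda>x. if x \<in> A then - d x else c x"
      have "(\<Sum>x\<in>?B. ?e x *s x) = (\<Sum>x\<in>C. ?e x *s x) + (\<Sum>x\<in>A. ?e x *s x)"
        unfolding \<open>?B = C \<union> A\<close> using fin B(1) \<open>C \<inter> A = {}\<close>
        by (intro sum.union_disjoint) (auto simp: C_def finite_subset)
      also have "(\<Sum>x\<in>C. ?e x *s x) = v"
        unfolding c using \<open>C \<inter> A = {}\<close> by (intro sum.cong) auto
      also have "(\<Sum>x\<in>A. ?e x *s x) = - v"
        by (simp add: d sum_negf)
      finally have "(\<Sum>x\<in>?B. ?e x *s x) = 0" by simp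
      then have e: "?e x = 0" if "x \<in> ?B" for x
        using vec.independentD[OF B(2) fin subset_refl, of ?e x] that by blast
      have "d x = 0" if "x \<in> A" for x
        using e[of x] that B(1) by auto
      then show "v = 0" unfolding d by simp
    qed
    then show ?thesis
      using spanA vec.span_zero[of A] vec.span_zero[of C] by blast
  qed
  moreover have "\<exists>w\<in>vec.span C. v - w \<in> ker" for v
  proof -
    have "v \<in> vec.span (C \<union> A)"
      using B(3) \<open>?B = C \<union> A\<close> by simp
    then obtain w u where "v = w + u" "w \<in> vec.span C" "u \<in> ker"
      unfolding vec.span_Un spanA by blast
    then show ?thesis
      by (auto intro!: bexI[of _ w])
  qed
  ultimately have "kbasis M (range g) (g ` C) \<and> inj_on g C"
    using \<open>finite C\<close> vec.independent_mono[OF B(2), of C] by (intro kbasis_image) (auto simp: C_def)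
  then show ?thesis
    using card card_image unfolding has_kdim_def by metis
qed

text \<open>This is the invariance of dimension, as \<open>has_kdim\<close> only asserts that some
  basis exists. One preimage is chosen for each element of the given basis. Uniqueness of
  coefficients makes the span of these preimages meet \<open>ker\<close> trivially, existence makes
  the two add up to the whole space, and the dimension formula for sums finishes the count.\<close>

lemma has_kdim_image_dim:
  assumes "has_kdim M (range g) n"
  shows "n + vec.dim ker = CARD('s)"
proof -
  obtain B where B: "kbasis M (range g) B" "card B = n"
    using assms by (auto simp: has_kdim_def)
  then have fin: "finite B" and "B \<subseteq> range g"
    by (auto simp: kbasis_def)
  then obtain C where C: "inj_on g C" "B = g ` C"
    unfolding subset_image_inj by blast
  with fin have C: "finite C" "inj_on g C" "B = g ` C"
    by (auto simp: finite_image_iff)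
  have unique: "\<exists>!c. c \<in> B \<rightarrow>\<^sub>E UNIV \<and> g v = g (\<Sum>x\<in>C. c (g x) *s x)" for v
    using B(1) unfolding kbasis_def C(3) g_sum_image[OF C(1,2)] by blast
  have trivial: "\<forall>x\<in>C. c x = 0" if "(\<Sum>x\<in>C. c x *s x) \<in> ker" for c
  proof -
    \<comment> \<open>Both \<open>d\<close>, which carries the coefficients \<open>c\<close>, and
      the zero function \<open>z\<close> represent the zero vector of \<open>M\<close>, so
      uniqueness identifies them.\<close>
    define d where "d = restrict (\<lambda>b. c (inv_into C g b)) B"
    define z where "z = restrict (\<lambda>_. 0 :: 'k) B"
    have "(\<Sum>x\<in>C. d (g x) *s x) = (\<Sum>x\<in>C. c x *s x)"
      by (rule sum.cong) (auto simp: d_def C)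
    then have "d \<in> B \<rightarrow>\<^sub>E UNIV \<and> g 0 = g (\<Sum>x\<in>C. d (g x) *s x)"
      using that by (auto simp: ker_def g_zero d_def)
    moreover have "(\<Sum>x\<in>C. z (g x) *s x) = 0"
      by (rule sum.neutral) (auto simp: z_def C)
    then have "z \<in> B \<rightarrow>\<^sub>E UNIV \<and> g 0 = g (\<Sum>x\<in>C. z (g x) *s x)"
      by (auto simp: z_def)
    ultimately have "d = z"
      using unique[of 0] by blast
    show ?thesis
    proof
      fix x assume "x \<in> C"
      then have "c x = d (g x)" "z (g x) = 0"
        by (simp_all add: d_def z_def C)
      then show "c x = 0"
        using \<open>d = z\<close> by simp
    qed
  qed
  have zero_ker: "0 \<in> ker"
    using vec.subspace_0[OF subspace_ker] .
  have ind: "vec.independent C"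
    unfolding vec.dependent_finite[OF C(1)] using trivial zero_ker by fastforce
  have "vec.span C \<inter> ker = {0}"
    using trivial zero_ker vec.span_zero[of C] by (auto simp: vec.span_finite[OF C(1)] intro!: sum.neutral)
  moreover have "{v + w |v w. v \<in> vec.span C \<and> w \<in> ker} = UNIV"
  proof -
    have "\<exists>v w. u = v + w \<and> v \<in> vec.span C \<and> w \<in> ker" for u
    proof -
      obtain c where "g u = g (\<Sum>x\<in>C. c (g x) *s x)"
        using unique[of u] by blast
      then have "u - (\<Sum>x\<in>C. c (g x) *s x) \<in> ker"
        by (simp add: g_diff_in_ker)
      moreover have "(\<Sum>x\<in>C. c (g x) *s x) \<in> vec.span C"
        by (intro vec.span_sum vec.span_scale vec.span_base)
      ultimately show ?thesis
        by (metis add.commute diff_add_cancel)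
    qed
    then show ?thesis by blast
  qed
  ultimately have "CARD('s) = vec.dim (vec.span C) + vec.dim ker"
    using vec.dim_sums_Int[OF vec.subspace_span[of C] subspace_ker] by (simp add: card_cart_basis)
  then show ?thesis
    using B(2) card_image[OF C(2)] vec.dim_eq_card_independent[OF ind] by (simp add: C(3))
qed

lemma has_kdim_image_iff: "has_kdim M (range g) n \<longleftrightarrow> n + vec.dim ker = CARD('s)"
  using has_kdim_imageI has_kdim_image_dim[of n] by (metis add_diff_cancel_right')

end

section \<open>Arithmetic in the path algebra\<close>

lemma Arrow_notin_range_Stationary [simp]: "Arrow i \<notin> range Stationary"
  by auto

lemma coeff_at_scalar_times: "coeff_at (scalar c * a) p = c * coeff_at a p"
  by (cases p) (simp_all add: coeff_at_simps coeff_at_scalar image_iff)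

lemma coeff_at_times_scalar: "coeff_at (a * scalar c) p = coeff_at a p * c"
  by (cases p) (simp_all add: coeff_at_simps coeff_at_scalar image_iff)

lemma coeff_at_Kronecker: "coeff_at (Kronecker f) = f"
  by (simp add: Kronecker_inverse)

text \<open>After this splitting the multiplication rules evaluate every coefficient, which lets
  simplification settle the identities of the algebra below.\<close>

lemma kronecker_eq_iff:
  "a = b \<longleftrightarrow> coeff_at a (Stationary V1) = coeff_at b (Stationary V1) \<and>
     coeff_at a (Stationary V2) = coeff_at b (Stationary V2) \<and>
     (\<forall>i. coeff_at a (Arrow i) = coeff_at b (Arrow i))"
proof -
  have "coeff_at a p = coeff_at b p"
    if "coeff_at a (Stationary V1) = coeff_at b (Stationary V1)"
      "coeff_at a (Stationary V2) = coeff_at b (Stationary V2)"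
      "\<forall>i. coeff_at a (Arrow i) = coeff_at b (Arrow i)" for p
    using that by (metis (full_types) kpath.exhaust vertex.exhaust)
  then show ?thesis
    by (auto intro: kronecker_eqI)
qed

lemmas kronecker_arith = kronecker_eq_iff coeff_at_simps coeff_at_scalar_times
  coeff_at_times_scalar coeff_at_scalar coeff_at_path_elem coeff_at_x_elem coeff_at_Kronecker

lemma scalar_add: "scalar (c + d) = scalar c + scalar d"
  by (simp add: kronecker_arith)

lemma scalar_mult: "scalar (c * d) = scalar c * scalar d"
  by (simp add: kronecker_arith)

lemma scalar_zero: "scalar 0 = 0"
  by (simp add: kronecker_arith)

lemma scalar_one: "scalar 1 = 1"
  by (simp add: kronecker_arith)

lemma x_elem_add: "x_elem (v + w) = x_elem v + x_elem w"
  by (simp add: kronecker_arith)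

lemma x_elem_scale: "x_elem (c *s v) = scalar c * x_elem v"
  by (simp add: kronecker_arith)

lemma x_elem_scalar: "x_elem v * scalar c = scalar c * x_elem v"
  by (simp add: kronecker_arith)

lemma x_elem_zero: "x_elem 0 = 0"
  by (simp add: kronecker_arith)

lemma inj_x_elem: "inj x_elem"
  by (rule injI) (simp add: kronecker_arith vec_eq_iff)

text \<open>Only the stationary path at vertex 2 can be composed after an arrow, so left
  multiplication on the span of the arrows is by scalars.\<close>

lemma times_x_elem: "a * x_elem v = scalar (coeff_at a (Stationary V2)) * x_elem v"
  by (simp add: kronecker_arith)

lemma times_e2: "a * e2 = scalar (coeff_at a (Stationary V2)) * e2"
  by (simp add: kronecker_arith)

lemma e1_plus_e2: "e1 + e2 = 1"
  by (simp add: kronecker_arith)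

definition arrow_coeffs :: "('k::field, 'r::finite) kronecker \<Rightarrow> 'k ^ 'r" where
  "arrow_coeffs a = (\<chi> i. coeff_at a (Arrow i))"

text \<open>The corner at vertex 1 is one-dimensional because the quiver has no cycles. It is the
  source of the uniqueness of generators up to a scalar.\<close>

lemma e1_times_e1: "e1 * a * e1 = scalar (coeff_at a (Stationary V1)) * e1"
  by (simp add: kronecker_arith)

lemma e2_times_e1: "e2 * a * e1 = x_elem (arrow_coeffs a) * e1"
  by (simp add: kronecker_arith arrow_coeffs_def)

section \<open>Modules generated at the first vertex\<close>

text \<open>Describes the nonzero quotients of \<open>P2\<close> with \<open>m\<close> as the image
  of \<open>e1\<close>. No dimension enters: finite dimension, dimension vector and
  indecomposability are all derived.\<close>

locale e1_generator = left_module M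
  for M :: "(('k::field, 'r::finite) kronecker, 'm) module" and m :: 'm +
  assumes gen_closed: "m \<in> carrier M"
    and e1_gen: "e1 \<odot>\<^bsub>M\<^esub> m = m"
    and gen_nonzero: "m \<noteq> \<zero>\<^bsub>M\<^esub>"
    and carrier_eq: "carrier M = range (\<lambda>a. a \<odot>\<^bsub>M\<^esub> m)"

text \<open>For a generator \<open>m\<close> at vertex 1, \<open>x_elem\<close> identifies this
  space with the kernel of the map from \<open>P2\<close> to \<open>M\<close> sending
  \<open>e1\<close> to \<open>m\<close>. It is the subspace \<open>U\<close> of the
  classification.\<close>

definition relations :: "(('k::field, 'r::finite) kronecker, 'm) module \<Rightarrow> 'm \<Rightarrow> ('k ^ 'r) set" where
  "relations M m = {v. x_elem v \<odot>\<^bsub>M\<^esub> m = \<zero>\<^bsub>M\<^esub>}"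

context e1_generator
begin

lemma e1_smult_gen: "e1 \<odot>\<^bsub>M\<^esub> (a \<odot>\<^bsub>M\<^esub> m) = scalar (coeff_at a (Stationary V1)) \<odot>\<^bsub>M\<^esub> m"
  by (metis e1_gen e1_times_e1 gen_closed smult_assoc)

lemma e2_smult_gen: "e2 \<odot>\<^bsub>M\<^esub> (a \<odot>\<^bsub>M\<^esub> m) = x_elem (arrow_coeffs a) \<odot>\<^bsub>M\<^esub> m"
  by (metis e1_gen e2_times_e1 gen_closed smult_assoc)

lemma scalar_gen_eq_zero_iff: "scalar c \<odot>\<^bsub>M\<^esub> m = \<zero>\<^bsub>M\<^esub> \<longleftrightarrow> c = 0"
proof -
  have "c = 0" if "scalar c \<odot>\<^bsub>M\<^esub> m = \<zero>\<^bsub>M\<^esub>"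
  proof (rule ccontr)
    assume "c \<noteq> 0"
    then have "m = scalar (inverse c) \<odot>\<^bsub>M\<^esub> (scalar c \<odot>\<^bsub>M\<^esub> m)"
      by (simp add: gen_closed scalar_one smult_one flip: smult_assoc scalar_mult)
    then show False
      using gen_nonzero that by simp
  qed
  then show ?thesis
    by (auto simp: scalar_zero gen_closed)
qed

text \<open>As \<open>e1 + e2 = 1\<close>, an element vanishes exactly if its components at both
  vertices do. The stationary path at vertex 2 kills \<open>m\<close>, so its coefficient leaves no
  trace in the annihilator.\<close>

lemma smult_gen_eq_zero_iff:
  "a \<odot>\<^bsub>M\<^esub> m = \<zero>\<^bsub>M\<^esub> \<longleftrightarrow> coeff_at a (Stationary V1) = 0 \<and> arrow_coeffs a \<in> relations M m"
proof -
  have "a \<odot>\<^bsub>M\<^esub> m = e1 \<odot>\<^bsub>M\<^esub> (a \<odot>\<^bsub>M\<^esub> m) \<oplus>\<^bsub>M\<^esub> e2 \<odot>\<^bsub>M\<^esub> (a \<odot>\<^bsub>M\<^esub> m)"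
    by (simp add: e1_plus_e2 gen_closed smult_closed smult_one flip: smult_l_distr)
  moreover have "e1 \<odot>\<^bsub>M\<^esub> (a \<odot>\<^bsub>M\<^esub> m) = \<zero>\<^bsub>M\<^esub> \<and> e2 \<odot>\<^bsub>M\<^esub> (a \<odot>\<^bsub>M\<^esub> m) = \<zero>\<^bsub>M\<^esub>"
    if "a \<odot>\<^bsub>M\<^esub> m = \<zero>\<^bsub>M\<^esub>"
    unfolding that by simp
  ultimately have "a \<odot>\<^bsub>M\<^esub> m = \<zero>\<^bsub>M\<^esub> \<longleftrightarrow>
      e1 \<odot>\<^bsub>M\<^esub> (a \<odot>\<^bsub>M\<^esub> m) = \<zero>\<^bsub>M\<^esub> \<and> e2 \<odot>\<^bsub>M\<^esub> (a \<odot>\<^bsub>M\<^esub> m) = \<zero>\<^bsub>M\<^esub>"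
    by (metis l_zero zero_closed)
  then show ?thesis
    by (simp add: e1_smult_gen e2_smult_gen scalar_gen_eq_zero_iff relations_def)
qed

section \<open>Coordinate spaces mapping onto \<open>M\<close> and onto its parts at the two
  vertices\<close>

interpretation whole: linear_into_module M "\<lambda>v :: 'k ^ 'r kpath. Kronecker (vec_nth v) \<odot>\<^bsub>M\<^esub> m"
proof
  fix v w :: "'k ^ 'r kpath" and c :: 'k
  have "Kronecker (vec_nth (v + w)) = Kronecker (vec_nth v) + Kronecker (vec_nth w)"
    "Kronecker (vec_nth (c *s v)) = scalar c * Kronecker (vec_nth v)"
    by (simp_all add: kronecker_arith)
  then show
    "Kronecker (vec_nth (v + w)) \<odot>\<^bsub>M\<^esub> m = Kronecker (vec_nth v) \<odot>\<^bsub>M\<^esub> m \<oplus>\<^bsub>M\<^esub> Kronecker (vec_nth w) \<odot>\<^bsub>M\<^esub> m"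
    "Kronecker (vec_nth (c *s v)) \<odot>\<^bsub>M\<^esub> m = scalar c \<odot>\<^bsub>M\<^esub> (Kronecker (vec_nth v) \<odot>\<^bsub>M\<^esub> m)"
    by (simp_all add: gen_closed smult_l_distr smult_assoc)
qed (simp add: gen_closed smult_closed)

interpretation part1: linear_into_module M "\<lambda>v :: 'k ^ 1. scalar (v $ 1) \<odot>\<^bsub>M\<^esub> m"
  by unfold_locales
    (simp_all add: gen_closed smult_closed smult_l_distr smult_assoc scalar_add scalar_mult)

interpretation part2: linear_into_module M "\<lambda>v :: 'k ^ 'r. x_elem v \<odot>\<^bsub>M\<^esub> m"
  by unfold_locales
    (simp_all add: gen_closed smult_closed smult_l_distr smult_assoc x_elem_add x_elem_scale)

lemma subspace_relations: "vec.subspace (relations M m)"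
  using part2.subspace_ker by (simp add: part2.ker_def relations_def)

lemma fd_module: "fd_module M"
proof -
  have "a \<odot>\<^bsub>M\<^esub> m = Kronecker (vec_nth (\<chi> p. coeff_at a p)) \<odot>\<^bsub>M\<^esub> m" for a
    by (simp add: vec_lambda_inverse coeff_at_inverse)
  then have "carrier M = range (\<lambda>v :: 'k ^ 'r kpath. Kronecker (vec_nth v) \<odot>\<^bsub>M\<^esub> m)"
    unfolding carrier_eq by blast
  then show ?thesis
    using whole.has_kdim_imageI left_module_axioms by (auto simp: fd_module_def)
qed

text \<open>Rank-nullity is applied to \<open>part1\<close>, which has zero kernel, and to
  \<open>part2\<close>, whose kernel is \<open>relations M m\<close>. Since the dimension of an
  image is unique, the result is an equivalence.\<close>

lemma has_dimension_vector_iff: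
  "has_dimension_vector M (1, n) \<longleftrightarrow> n + vec.dim (relations M m) = CARD('r)"
proof -
  have "(\<lambda>x. e1 \<odot>\<^bsub>M\<^esub> x) ` carrier M = range (\<lambda>a :: ('k, 'r) kronecker. scalar (coeff_at a (Stationary V1)) \<odot>\<^bsub>M\<^esub> m)"
    unfolding carrier_eq image_image e1_smult_gen ..
  \<comment> \<open>The ground field appears as the coordinate space \<open>'k ^ 1\<close>, the form
    that \<open>linear_into_module\<close> expects.\<close>
  also have "\<dots> = range (\<lambda>v :: 'k ^ 1. scalar (v $ 1) \<odot>\<^bsub>M\<^esub> m)"
  proof -
    have "scalar (coeff_at a (Stationary V1)) \<odot>\<^bsub>M\<^esub> m =
        scalar ((\<chi> i. coeff_at a (Stationary V1)) $ (1 :: 1)) \<odot>\<^bsub>M\<^esub> m"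
      for a :: "('k, 'r) kronecker"
      by simp
    moreover have "scalar (v $ 1) \<odot>\<^bsub>M\<^esub> m =
        scalar (coeff_at (scalar (v $ 1) :: ('k, 'r) kronecker) (Stationary V1)) \<odot>\<^bsub>M\<^esub> m" for v :: "'k ^ 1"
      by (simp add: coeff_at_scalar)
    ultimately show ?thesis by blast
  qed
  finally have e1: "(\<lambda>x. e1 \<odot>\<^bsub>M\<^esub> x) ` carrier M = range (\<lambda>v :: 'k ^ 1. scalar (v $ 1) \<odot>\<^bsub>M\<^esub> m)" .
  have "(\<lambda>x. e2 \<odot>\<^bsub>M\<^esub> x) ` carrier M = range (\<lambda>a. x_elem (arrow_coeffs a) \<odot>\<^bsub>M\<^esub> m)"
    unfolding carrier_eq image_image e2_smult_gen ..
  also have "\<dots> = range (\<lambda>v. x_elem v \<odot>\<^bsub>M\<^esub> m)"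
  proof -
    have "arrow_coeffs (x_elem v) = v" for v :: "'k ^ 'r"
      by (simp add: arrow_coeffs_def coeff_at_x_elem)
    then have "surj (arrow_coeffs :: ('k, 'r) kronecker \<Rightarrow> _)"
      by (rule surjI)
    then show ?thesis
      using image_image[of "\<lambda>v. x_elem v \<odot>\<^bsub>M\<^esub> m" arrow_coeffs "UNIV :: ('k, 'r) kronecker set"]
      by simp
  qed
  finally have e2: "(\<lambda>x. e2 \<odot>\<^bsub>M\<^esub> x) ` carrier M = range (\<lambda>v. x_elem v \<odot>\<^bsub>M\<^esub> m)" .
  have "part1.ker = {0}"
    by (auto simp: part1.ker_def scalar_gen_eq_zero_iff vec_eq_iff forall_1)
  then have "has_kdim M ((\<lambda>x. e1 \<odot>\<^bsub>M\<^esub> x) ` carrier M) 1"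
    unfolding e1 part1.has_kdim_image_iff by simp
  moreover have "part2.ker = relations M m"
    by (simp add: part2.ker_def relations_def)
  ultimately show ?thesis
    by (simp add: has_dimension_vector_def e2 part2.has_kdim_image_iff)
qed

lemma submodule_eq_carrier:
  assumes "submodule_of A M" "m \<in> A"
  shows "A = carrier M"
  using assms by (auto simp: submodule_of_def carrier_eq)

lemma indecomposable: "indecomposable M"
  unfolding indecomposable_def
proof (intro conjI allI impI fd_module)
  show "carrier M \<noteq> {\<zero>\<^bsub>M\<^esub>}"
    using gen_closed gen_nonzero by auto
next
  fix A B
  assume *: "submodule_of A M \<and> submodule_of B M \<and> A <+>\<^bsub>M\<^esub> B = carrier M \<and> A \<inter> B = {\<zero>\<^bsub>M\<^esub>}"
  then have "m \<in> A <+>\<^bsub>M\<^esub> B"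
    using gen_closed by simp
  then obtain a b where ab: "a \<in> A" "b \<in> B" "m = a \<oplus>\<^bsub>M\<^esub> b"
    unfolding set_add_def' by blast
  \<comment> \<open>The vector \<open>e1\<close> times \<open>x\<close> is a nonzero multiple of
    \<open>m\<close>, and dividing by the scalar puts \<open>m\<close> itself into
    \<open>S\<close>.\<close>
  have gen_in: "m \<in> S" if S: "submodule_of S M" and x: "x \<in> S" "e1 \<odot>\<^bsub>M\<^esub> x \<noteq> \<zero>\<^bsub>M\<^esub>" for S x
  proof -
    have "x \<in> carrier M"
      using S x(1) by (auto simp: submodule_of_def)
    then obtain c where c: "e1 \<odot>\<^bsub>M\<^esub> x = scalar c \<odot>\<^bsub>M\<^esub> m"
      using e1_smult_gen by (auto simp: carrier_eq)
    with x(2) have "c \<noteq> 0"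
      by (simp add: scalar_gen_eq_zero_iff)
    then have "m = scalar (inverse c) \<odot>\<^bsub>M\<^esub> (e1 \<odot>\<^bsub>M\<^esub> x)"
      unfolding c by (simp add: gen_closed scalar_one smult_one flip: smult_assoc scalar_mult)
    then show ?thesis
      using S x(1) by (auto simp: submodule_of_def)
  qed
  have "a \<in> carrier M" "b \<in> carrier M"
    using * ab by (auto simp: submodule_of_def)
  then have "m = e1 \<odot>\<^bsub>M\<^esub> a \<oplus>\<^bsub>M\<^esub> e1 \<odot>\<^bsub>M\<^esub> b"
    using e1_gen unfolding ab(3) by (simp add: smult_r_distr)
  then have "e1 \<odot>\<^bsub>M\<^esub> a \<noteq> \<zero>\<^bsub>M\<^esub> \<or> e1 \<odot>\<^bsub>M\<^esub> b \<noteq> \<zero>\<^bsub>M\<^esub>"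
    using gen_nonzero by auto
  then have "A = carrier M \<or> B = carrier M"
    using * ab gen_in submodule_eq_carrier by blast
  moreover have "A \<subseteq> carrier M" "B \<subseteq> carrier M"
    using * by (auto simp: submodule_of_def)
  ultimately show "A = {\<zero>\<^bsub>M\<^esub>} \<or> B = {\<zero>\<^bsub>M\<^esub>}"
    using * by blast
qed

text \<open>Two generators at vertex 1 differ by a nonzero scalar, and scalars commute with
  \<open>x_elem\<close>. Thus the subspace is an invariant of the module, which yields injectivity
  of the map in (b).\<close>

lemma relations_unique:
  assumes "e1_generator M n"
  shows "relations M n = relations M m"
proof -
  interpret n: e1_generator M n by fact
  obtain a where "n = a \<odot>\<^bsub>M\<^esub> m"
    using n.gen_closed by (auto simp: carrier_eq)
  then obtain c where c: "n = scalar c \<odot>\<^bsub>M\<^esub> m"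
    using n.e1_gen e1_smult_gen by metis
  then have "c \<noteq> 0"
    using n.gen_nonzero by (auto simp: scalar_zero gen_closed)
  have "x_elem v \<odot>\<^bsub>M\<^esub> n = scalar c \<odot>\<^bsub>M\<^esub> (x_elem v \<odot>\<^bsub>M\<^esub> m)" for v
    by (simp add: c gen_closed x_elem_scalar flip: smult_assoc)
  moreover have "scalar c \<odot>\<^bsub>M\<^esub> y = \<zero>\<^bsub>M\<^esub> \<longleftrightarrow> y = \<zero>\<^bsub>M\<^esub>" if "y \<in> carrier M" for y
  proof -
    have "y = scalar (inverse c) \<odot>\<^bsub>M\<^esub> (scalar c \<odot>\<^bsub>M\<^esub> y)"
      using \<open>c \<noteq> 0\<close> that by (simp add: scalar_one smult_one flip: smult_assoc scalar_mult)
    then show ?thesis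
      by (metis smult_zero_right)
  qed
  ultimately show ?thesis
    by (simp add: relations_def gen_closed smult_closed)
qed

text \<open>All generator conditions except non-vanishing pass along epimorphisms. It serves both
  isomorphisms and the projection from \<open>P2\<close> to \<open>X_mod U\<close>.\<close>

lemma e1_generator_image:
  assumes "left_module N" "\<pi> \<in> module_epis M N" "\<pi> m \<noteq> \<zero>\<^bsub>N\<^esub>"
  shows "e1_generator N (\<pi> m)"
    and "relations N (\<pi> m) = {v. \<pi> (x_elem v \<odot>\<^bsub>M\<^esub> m) = \<zero>\<^bsub>N\<^esub>}"
proof -
  have hom: "\<pi> \<in> module_homs M N" and surj: "\<pi> ` carrier M = carrier N"
    using assms(2) by (auto simp: module_epis_def)
  have smult: "\<pi> (a \<odot>\<^bsub>M\<^esub> m) = a \<odot>\<^bsub>N\<^esub> \<pi> m" for a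
    using module_homsD(3)[OF hom gen_closed] .
  show "e1_generator N (\<pi> m)"
  proof (intro e1_generator.intro e1_generator_axioms.intro)
    show "\<pi> m \<in> carrier N"
      by (rule module_homsD(1)[OF hom gen_closed])
    show "e1 \<odot>\<^bsub>N\<^esub> \<pi> m = \<pi> m"
      using smult[of e1] by (simp add: e1_gen)
    show "carrier N = range (\<lambda>a. a \<odot>\<^bsub>N\<^esub> \<pi> m)"
      unfolding surj[symmetric] carrier_eq image_image smult ..
  qed fact+
  show "relations N (\<pi> m) = {v. \<pi> (x_elem v \<odot>\<^bsub>M\<^esub> m) = \<zero>\<^bsub>N\<^esub>}"
    by (simp add: relations_def smult)
qed

lemma e1_generator_isomorphic:
  assumes "M \<cong>\<^sub>m N"
  shows "\<exists>n. e1_generator N n \<and> relations N n = relations M m"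
proof -
  obtain f where f: "f \<in> module_homs M N" "bij_betw f (carrier M) (carrier N)" and N: "left_module N"
    using assms by (auto simp: module_isomorphic_def)
  have epi: "f \<in> module_epis M N"
    using f by (auto simp: module_epis_def bij_betw_def)
  have zero: "f x = \<zero>\<^bsub>N\<^esub> \<longleftrightarrow> x = \<zero>\<^bsub>M\<^esub>" if "x \<in> carrier M" for x
    using module_hom_zero[OF left_module_axioms N f(1)] f(2) that
    by (metis bij_betw_inv_into_left zero_closed)
  have "f m \<noteq> \<zero>\<^bsub>N\<^esub>"
    using gen_nonzero by (simp add: zero gen_closed)
  then have "e1_generator N (f m)" "relations N (f m) = relations M m"
    using e1_generator_image[OF N epi] by (auto simp: relations_def zero gen_closed smult_closed)
  then show ?thesis by blast
qed

text \<open>The inclusion of relations gives an inclusion of annihilators by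
  \<open>smult_gen_eq_zero_iff\<close>, so sending \<open>a\<close> times \<open>m\<close> to
  \<open>a\<close> times \<open>n\<close> is well defined. It yields the epimorphism of (c) and, for
  equal relations, an isomorphism.\<close>

lemma generator_map:
  assumes "e1_generator N n" "relations M m \<subseteq> relations N n"
  shows "\<exists>f\<in>module_epis M N. \<forall>a. f (a \<odot>\<^bsub>M\<^esub> m) = a \<odot>\<^bsub>N\<^esub> n"
proof -
  interpret N: e1_generator N n by fact
  \<comment> \<open>An arbitrary coefficient representing \<open>x\<close> is chosen; the next fact
    shows that the choice does not matter.\<close>
  define f where "f x = (SOME a. x = a \<odot>\<^bsub>M\<^esub> m) \<odot>\<^bsub>N\<^esub> n" for x
  have f: "f (a \<odot>\<^bsub>M\<^esub> m) = a \<odot>\<^bsub>N\<^esub> n" for a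
  proof -
    define b where "b = (SOME b. a \<odot>\<^bsub>M\<^esub> m = b \<odot>\<^bsub>M\<^esub> m)"
    have "a \<odot>\<^bsub>M\<^esub> m = b \<odot>\<^bsub>M\<^esub> m"
      unfolding b_def by (rule someI[of _ a]) simp
    then have "(b - a) \<odot>\<^bsub>M\<^esub> m = \<zero>\<^bsub>M\<^esub>"
      by (simp add: smult_diff_eq_zero_iff gen_closed)
    then have "(b - a) \<odot>\<^bsub>N\<^esub> n = \<zero>\<^bsub>N\<^esub>"
      using assms(2) by (auto simp: smult_gen_eq_zero_iff N.smult_gen_eq_zero_iff)
    then show ?thesis
      by (simp add: f_def b_def N.smult_diff_eq_zero_iff N.gen_closed)
  qed
  have "f \<in> module_homs M N"
  proof (rule module_homsI)
    show "f x \<in> carrier N" if "x \<in> carrier M" for x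
      using that by (auto simp: carrier_eq N.carrier_eq f)
    show "f (x \<oplus>\<^bsub>M\<^esub> y) = f x \<oplus>\<^bsub>N\<^esub> f y" if "x \<in> carrier M" "y \<in> carrier M" for x y
    proof -
      obtain a b where "x = a \<odot>\<^bsub>M\<^esub> m" "y = b \<odot>\<^bsub>M\<^esub> m"
        using \<open>x \<in> carrier M\<close> \<open>y \<in> carrier M\<close> by (auto simp: carrier_eq)
      then show ?thesis
        using f[of "a + b"] by (simp add: f gen_closed N.gen_closed smult_l_distr N.smult_l_distr)
    qed
    show "f (a \<odot>\<^bsub>M\<^esub> x) = a \<odot>\<^bsub>N\<^esub> f x" if "x \<in> carrier M" for a x
    proof -
      obtain b where "x = b \<odot>\<^bsub>M\<^esub> m"
        using \<open>x \<in> carrier M\<close> by (auto simp: carrier_eq)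
      then show ?thesis
        using f[of "a * b"] by (simp add: f gen_closed N.gen_closed smult_assoc N.smult_assoc)
    qed
  qed
  moreover have "f ` carrier M = carrier N"
    unfolding carrier_eq N.carrier_eq image_image f ..
  ultimately show ?thesis
    using f by (auto simp: module_epis_def)
qed

text \<open>Equal relations mean equal annihilators, so the epimorphism of
  \<open>generator_map\<close> is also injective.\<close>

lemma isomorphic_if_relations_eq:
  assumes "e1_generator N n" "relations N n = relations M m"
  shows "M \<cong>\<^sub>m N"
proof -
  interpret N: e1_generator N n by fact
  obtain f where epi: "f \<in> module_epis M N" and f: "\<And>a. f (a \<odot>\<^bsub>M\<^esub> m) = a \<odot>\<^bsub>N\<^esub> n"
    using generator_map[OF assms(1)] assms(2) by auto
  have "inj_on f (carrier M)"
  proof (rule inj_onI)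
    fix x y assume "x \<in> carrier M" "y \<in> carrier M" and eq: "f x = f y"
    then obtain a b where ab: "x = a \<odot>\<^bsub>M\<^esub> m" "y = b \<odot>\<^bsub>M\<^esub> m"
      by (auto simp: carrier_eq)
    then have "(a - b) \<odot>\<^bsub>N\<^esub> n = \<zero>\<^bsub>N\<^esub>"
      using eq by (simp add: f N.smult_diff_eq_zero_iff N.gen_closed)
    then have "(a - b) \<odot>\<^bsub>M\<^esub> m = \<zero>\<^bsub>M\<^esub>"
      using assms(2) by (simp add: smult_gen_eq_zero_iff N.smult_gen_eq_zero_iff)
    then show "x = y"
      by (simp add: ab smult_diff_eq_zero_iff gen_closed)
  qed
  then show ?thesis
    using epi left_module_axioms N.left_module_axioms
    by (auto simp: module_isomorphic_def module_epis_def bij_betw_def)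
qed

end

section \<open>Indecomposable modules of dimension vector (1, n)\<close>

text \<open>
  The complement is a maximal submodule \<open>W\<close> of \<open>e\<^sub>2M\<close> meeting \<open>S = \<K>m\<close> trivially: if
  \<open>y \<in> e\<^sub>2M\<close> were not in \<open>S + W\<close>, then \<open>W + ky\<close> would be larger.
\<close>

lemma indecomposable_generator:
  fixes M :: "(('k::field, 'r::finite) kronecker, 'm) module"
  assumes ind: "indecomposable M" and dimv: "has_dimension_vector M (1, n)"
  shows "\<exists>m. e1_generator M m"
proof -
  interpret left_module M
    using ind by (auto simp: indecomposable_def fd_module_def)
  let ?E1 = "(\<lambda>x. e1 \<odot>\<^bsub>M\<^esub> x) ` carrier M" and ?E2 = "(\<lambda>x. e2 \<odot>\<^bsub>M\<^esub> x) ` carrier M"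
  have e1e1: "e1 * e1 = (e1 :: ('k, 'r) kronecker)" and e2e2: "e2 * e2 = (e2 :: ('k, 'r) kronecker)"
    by (simp_all add: kronecker_arith)
  obtain m where kb: "kbasis M ?E1 {m}"
    using dimv by (auto simp: has_dimension_vector_def has_kdim_def card_1_singleton_iff)
  have m: "m \<in> ?E1"
    and basis: "\<And>v. v \<in> ?E1 \<Longrightarrow>
      \<exists>!c. c \<in> {m} \<rightarrow>\<^sub>E UNIV \<and> v = finsum M (\<lambda>b. scalar (c b) \<odot>\<^bsub>M\<^esub> b) {m}"
    using kb unfolding kbasis_def by blast+
  have closed: "m \<in> carrier M" and e1m: "e1 \<odot>\<^bsub>M\<^esub> m = m"
    using m by (auto simp: smult_closed e1e1 simp flip: smult_assoc)
  have sing: "finsum M (\<lambda>b. scalar (c b) \<odot>\<^bsub>M\<^esub> b) {m} = scalar (c m) \<odot>\<^bsub>M\<^esub> m" for c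
    using closed by (simp add: smult_closed)
  \<comment> \<open>If \<open>m\<close> were zero, the coefficient functions 0 and 1 on
    \<open>{m}\<close> would both represent it, against uniqueness.\<close>
  have nonzero: "m \<noteq> \<zero>\<^bsub>M\<^esub>"
  proof
    assume "m = \<zero>\<^bsub>M\<^esub>"
    then have "(\<lambda>b\<in>{m}. 0 :: 'k) = (\<lambda>b\<in>{m}. 1)"
      using basis[OF m] unfolding sing by (auto simp: restrict_PiE_iff)
    then show False
      by (metis restrict_apply' singletonI zero_neq_one)
  qed
  define S where "S = range (\<lambda>a. a \<odot>\<^bsub>M\<^esub> m)"
  have S: "submodule_of S M"
    unfolding S_def by (rule submodule_cyclic) (rule closed)
  have E1: "?E1 \<subseteq> S"
  proof
    fix v assume "v \<in> ?E1"
    then obtain c where "v = scalar (c m) \<odot>\<^bsub>M\<^esub> m"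
      using basis unfolding sing by blast
    then show "v \<in> S" by (auto simp: S_def)
  qed
  let ?W = "{W. submodule_of W M \<and> W \<subseteq> ?E2 \<and> S \<inter> W = {\<zero>\<^bsub>M\<^esub>}}"
  \<comment> \<open>Arrows kill the part at vertex 2, so the submodules inside it are its subspaces.
    Zorn's lemma applies because the family is closed under unions of nonempty chains.\<close>
  have "\<exists>W\<in>?W. \<forall>X\<in>?W. W \<subseteq> X \<longrightarrow> X = W"
  proof (rule subset_Zorn_nonempty)
    have "\<zero>\<^bsub>M\<^esub> \<in> ?E2"
      by (metis imageI smult_zero_right zero_closed)
    then have "{\<zero>\<^bsub>M\<^esub>} \<in> ?W"
      using S by (auto simp: submodule_of_def)
    then show "?W \<noteq> {}" by blast
  next
    fix \<C> assume ne: "\<C> \<noteq> {}" and chain: "subset.chain ?W \<C>"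
    have sub: "submodule_of X M" and E2: "X \<subseteq> ?E2" and cap: "S \<inter> X = {\<zero>\<^bsub>M\<^esub>}"
      if "X \<in> \<C>" for X
      using chain that unfolding subset.chain_def by auto
    have "submodule_of (\<Union>\<C>) M"
      unfolding submodule_of_def
    proof (intro conjI ballI allI)
      show "\<Union>\<C> \<subseteq> carrier M"
        using sub unfolding submodule_of_def by blast
      show "\<zero>\<^bsub>M\<^esub> \<in> \<Union>\<C>"
        using sub ne unfolding submodule_of_def by blast
    next
      fix x y assume "x \<in> \<Union>\<C>" "y \<in> \<Union>\<C>"
      then obtain X Y where "X \<in> \<C>" "x \<in> X" "Y \<in> \<C>" "y \<in> Y"
        by blast
      moreover have "X \<subseteq> Y \<or> Y \<subseteq> X"
        using chain \<open>X \<in> \<C>\<close> \<open>Y \<in> \<C>\<close> unfolding subset.chain_def by blast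
      ultimately obtain Z where "Z \<in> \<C>" "x \<in> Z" "y \<in> Z"
        by blast
      then have "x \<oplus>\<^bsub>M\<^esub> y \<in> Z"
        using sub[of Z] by (simp add: submodule_of_def)
      then show "x \<oplus>\<^bsub>M\<^esub> y \<in> \<Union>\<C>"
        using \<open>Z \<in> \<C>\<close> by blast
    next
      fix a x assume "x \<in> \<Union>\<C>"
      then show "a \<odot>\<^bsub>M\<^esub> x \<in> \<Union>\<C>"
        using sub unfolding submodule_of_def by blast
    qed
    moreover have "\<Union>\<C> \<subseteq> ?E2"
      using E2 by blast
    moreover have "S \<inter> \<Union>\<C> = {\<zero>\<^bsub>M\<^esub>}"
      using cap ne by blast
    ultimately show "\<Union>\<C> \<in> ?W"
      by blast
  qed
  then obtain W where W: "submodule_of W M" "W \<subseteq> ?E2" "S \<inter> W = {\<zero>\<^bsub>M\<^esub>}"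
    and max: "\<And>X. submodule_of X M \<Longrightarrow> X \<subseteq> ?E2 \<Longrightarrow> S \<inter> X = {\<zero>\<^bsub>M\<^esub>} \<Longrightarrow> W \<subseteq> X \<Longrightarrow> X = W"
    by auto
  have Wc: "W \<subseteq> carrier M" and Sc: "S \<subseteq> carrier M"
    using W(1) S by (auto simp: submodule_of_def)
  have sumI: "s \<oplus>\<^bsub>M\<^esub> w \<in> S <+>\<^bsub>M\<^esub> W" if "s \<in> S" "w \<in> W" for s w
    using that by (auto simp: set_add_def')
  have S0: "\<zero>\<^bsub>M\<^esub> \<in> S" and W0: "\<zero>\<^bsub>M\<^esub> \<in> W"
    using S W(1) by (auto simp: submodule_of_def)
  have E2: "y \<in> S <+>\<^bsub>M\<^esub> W" if y: "y \<in> ?E2" for y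
  proof (rule ccontr)
    assume notin: "y \<notin> S <+>\<^bsub>M\<^esub> W"
    have yc: "y \<in> carrier M" and e2y: "e2 \<odot>\<^bsub>M\<^esub> y = y"
      using y by (auto simp: smult_closed e2e2 simp flip: smult_assoc)
    \<comment> \<open>The algebra acts on \<open>y\<close> through scalars only, so the set
      \<open>X\<close> below is \<open>W\<close> enlarged by the line through
      \<open>y\<close>.\<close>
    have ay: "a \<odot>\<^bsub>M\<^esub> y = scalar (coeff_at a (Stationary V2)) \<odot>\<^bsub>M\<^esub> y" for a
      by (metis e2y smult_assoc times_e2 yc)
    define X where "X = {w \<oplus>\<^bsub>M\<^esub> a \<odot>\<^bsub>M\<^esub> y | w a. w \<in> W}"
    have XI: "w \<oplus>\<^bsub>M\<^esub> a \<odot>\<^bsub>M\<^esub> y \<in> X" if "w \<in> W" for w a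
      using that by (auto simp: X_def)
    have "W \<subseteq> X"
    proof
      fix w assume "w \<in> W"
      then have "w \<oplus>\<^bsub>M\<^esub> 0 \<odot>\<^bsub>M\<^esub> y = w"
        using yc Wc by auto
      then show "w \<in> X"
        using XI[OF \<open>w \<in> W\<close>, of 0] by simp
    qed
    have "y \<in> X"
      using XI[OF W0, of 1] yc by (simp add: smult_one)
    have "submodule_of X M"
      unfolding submodule_of_def
    proof (intro conjI ballI allI)
      show "X \<subseteq> carrier M"
        using Wc yc by (auto simp: X_def smult_closed)
      show "\<zero>\<^bsub>M\<^esub> \<in> X"
        using W0 \<open>W \<subseteq> X\<close> by blast
    next
      fix u v assume "u \<in> X" "v \<in> X"
      then obtain w a w' b where u: "u = w \<oplus>\<^bsub>M\<^esub> a \<odot>\<^bsub>M\<^esub> y" "v = w' \<oplus>\<^bsub>M\<^esub> b \<odot>\<^bsub>M\<^esub> y"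
        and w: "w \<in> W" "w' \<in> W"
        by (auto simp: X_def)
      have "w \<in> carrier M" "w' \<in> carrier M"
        using w Wc by auto
      then have "u \<oplus>\<^bsub>M\<^esub> v = (w \<oplus>\<^bsub>M\<^esub> w') \<oplus>\<^bsub>M\<^esub> (a + b) \<odot>\<^bsub>M\<^esub> y"
        using yc by (simp add: u smult_l_distr smult_closed a_ac)
      moreover have "w \<oplus>\<^bsub>M\<^esub> w' \<in> W"
        using W(1) w by (auto simp: submodule_of_def)
      ultimately show "u \<oplus>\<^bsub>M\<^esub> v \<in> X"
        by (simp add: XI)
    next
      fix a u assume "u \<in> X"
      then obtain w b where u: "u = w \<oplus>\<^bsub>M\<^esub> b \<odot>\<^bsub>M\<^esub> y" and w: "w \<in> W"
        by (auto simp: X_def)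
      then have "a \<odot>\<^bsub>M\<^esub> u = a \<odot>\<^bsub>M\<^esub> w \<oplus>\<^bsub>M\<^esub> (a * b) \<odot>\<^bsub>M\<^esub> y"
        using yc Wc by (auto simp: smult_r_distr smult_closed smult_assoc)
      moreover have "a \<odot>\<^bsub>M\<^esub> w \<in> W"
        using W(1) w by (auto simp: submodule_of_def)
      ultimately show "a \<odot>\<^bsub>M\<^esub> u \<in> X"
        by (simp add: XI)
    qed
    moreover have "X \<subseteq> ?E2"
    proof
      fix u assume "u \<in> X"
      then obtain w b where u: "u = w \<oplus>\<^bsub>M\<^esub> b \<odot>\<^bsub>M\<^esub> y" and w: "w \<in> W"
        by (auto simp: X_def)
      obtain w' where w': "w' \<in> carrier M" "w = e2 \<odot>\<^bsub>M\<^esub> w'"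
        using w W(2) by auto
      \<comment> \<open>Scalars commute with \<open>e2\<close>, which keeps the multiples of
        \<open>y\<close> at vertex 2.\<close>
      have "scalar (coeff_at b (Stationary V2)) * e2 = e2 * scalar (coeff_at b (Stationary V2))"
        by (simp add: kronecker_arith)
      then have "b \<odot>\<^bsub>M\<^esub> y = e2 \<odot>\<^bsub>M\<^esub> (scalar (coeff_at b (Stationary V2)) \<odot>\<^bsub>M\<^esub> y)"
        by (metis ay e2y smult_assoc yc)
      then have "u = e2 \<odot>\<^bsub>M\<^esub> (w' \<oplus>\<^bsub>M\<^esub> scalar (coeff_at b (Stationary V2)) \<odot>\<^bsub>M\<^esub> y)"
        using w' yc by (simp add: u smult_r_distr smult_closed)
      then show "u \<in> ?E2"
        using w' yc by (auto simp: smult_closed)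
    qed
    moreover have "S \<inter> X = {\<zero>\<^bsub>M\<^esub>}"
    proof -
      have "u = \<zero>\<^bsub>M\<^esub>" if "u \<in> S" "u \<in> X" for u
      proof -
        obtain w b where u: "u = w \<oplus>\<^bsub>M\<^esub> b \<odot>\<^bsub>M\<^esub> y" and w: "w \<in> W"
          using \<open>u \<in> X\<close> by (auto simp: X_def)
        define c where "c = coeff_at b (Stationary V2)"
        have u': "u = w \<oplus>\<^bsub>M\<^esub> scalar c \<odot>\<^bsub>M\<^esub> y"
          using u ay[of b] by (simp add: c_def)
        have carr: "u \<in> carrier M" "w \<in> carrier M"
          using w Wc \<open>u \<in> S\<close> Sc by auto
        \<comment> \<open>With \<open>c\<close> invertible the equation could be solved for
          \<open>y\<close>, which would then lie in \<open>S <+> W\<close>.\<close>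
        have "c = 0"
        proof (rule ccontr)
          assume "c \<noteq> 0"
          then have "y = scalar (inverse c) \<odot>\<^bsub>M\<^esub> (scalar c \<odot>\<^bsub>M\<^esub> y)"
            using yc by (simp add: scalar_one smult_one flip: smult_assoc scalar_mult)
          also have "scalar c \<odot>\<^bsub>M\<^esub> y = u \<oplus>\<^bsub>M\<^esub> (- 1) \<odot>\<^bsub>M\<^esub> w"
            using carr yc
            by (simp add: u' smult_minus_left smult_one smult_closed a_ac r_neg2 r_neg1)
          finally have "y = scalar (inverse c) \<odot>\<^bsub>M\<^esub> u \<oplus>\<^bsub>M\<^esub>
              scalar (inverse c) \<odot>\<^bsub>M\<^esub> ((- 1) \<odot>\<^bsub>M\<^esub> w)"
            using carr by (simp add: smult_r_distr smult_closed)
          moreover have "scalar (inverse c) \<odot>\<^bsub>M\<^esub> u \<in> S"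
            "scalar (inverse c) \<odot>\<^bsub>M\<^esub> ((- 1) \<odot>\<^bsub>M\<^esub> w) \<in> W"
            using S W(1) \<open>u \<in> S\<close> w by (auto simp: submodule_of_def)
          ultimately show False
            using notin sumI by metis
        qed
        then have "u = w"
          using u' carr yc by (simp add: scalar_zero)
        then show ?thesis
          using w W(3) \<open>u \<in> S\<close> by blast
      qed
      then show ?thesis
        using S0 W0 \<open>W \<subseteq> X\<close> by blast
    qed
    \<comment> \<open>Maximality would put \<open>y\<close> into \<open>W\<close>, hence into
      \<open>S <+> W\<close>.\<close>
    ultimately have "X = W"
      using max \<open>W \<subseteq> X\<close> by blast
    then have "\<zero>\<^bsub>M\<^esub> \<oplus>\<^bsub>M\<^esub> y \<in> S <+>\<^bsub>M\<^esub> W"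
      using \<open>y \<in> X\<close> by (intro sumI S0) simp
    then show False
      using notin yc by simp
  qed
  have "carrier M \<subseteq> S <+>\<^bsub>M\<^esub> W"
  proof
    fix x assume x: "x \<in> carrier M"
    obtain s w where sw: "s \<in> S" "w \<in> W" "e2 \<odot>\<^bsub>M\<^esub> x = s \<oplus>\<^bsub>M\<^esub> w"
      using E2[of "e2 \<odot>\<^bsub>M\<^esub> x"] x by (auto simp: set_add_def')
    have s': "e1 \<odot>\<^bsub>M\<^esub> x \<in> S"
      using E1 x by blast
    have "x = e1 \<odot>\<^bsub>M\<^esub> x \<oplus>\<^bsub>M\<^esub> e2 \<odot>\<^bsub>M\<^esub> x"
      using x by (simp add: e1_plus_e2 smult_one flip: smult_l_distr)
    also have "\<dots> = (e1 \<odot>\<^bsub>M\<^esub> x \<oplus>\<^bsub>M\<^esub> s) \<oplus>\<^bsub>M\<^esub> w"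
      unfolding sw(3) using sw(1,2) Sc Wc x by (intro a_assoc[symmetric]) (auto simp: smult_closed)
    finally show "x \<in> S <+>\<^bsub>M\<^esub> W"
      using S s' sw(1,2) sumI by (metis submodule_of_def)
  qed
  moreover have "S <+>\<^bsub>M\<^esub> W \<subseteq> carrier M"
    using Sc Wc by (auto simp: set_add_def')
  ultimately have "S = {\<zero>\<^bsub>M\<^esub>} \<or> W = {\<zero>\<^bsub>M\<^esub>}"
    using ind S W(1,3) unfolding indecomposable_def by blast
  moreover have "m \<in> S"
    unfolding S_def by (metis closed rangeI smult_one)
  ultimately have "W = {\<zero>\<^bsub>M\<^esub>}"
    using nonzero by blast
  have "carrier M = S"
  proof
    show "carrier M \<subseteq> S"
    proof
      fix x assume "x \<in> carrier M"
      then have "x \<in> S <+>\<^bsub>M\<^esub> {\<zero>\<^bsub>M\<^esub>}"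
        using \<open>carrier M \<subseteq> S <+>\<^bsub>M\<^esub> W\<close> unfolding \<open>W = {\<zero>\<^bsub>M\<^esub>}\<close> by blast
      then obtain s where "s \<in> S" "x = s \<oplus>\<^bsub>M\<^esub> \<zero>\<^bsub>M\<^esub>"
        unfolding set_add_def' by blast
      then show "x \<in> S"
        using Sc by auto
    qed
  qed fact
  then have "e1_generator M m"
    using closed e1m nonzero unfolding S_def by unfold_locales auto
  then show ?thesis ..
qed

section \<open>The modules attached to subspaces\<close>

lemma P2_generator: "e1_generator (P2 :: (('k::field, 'r::finite) kronecker, _) module) e1"
proof -
  \<comment> \<open>Membership in the left ideal generated by \<open>e1\<close> is existential;
    these are its closure under sums, left multiples, zero and negatives.\<close>
  have ex: "\<exists>c. a * e1 + b * e1 = c * e1" "\<exists>c. a * (b * e1) = c * e1"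
    "\<exists>c. c * e1 = 0" "\<exists>c. a * e1 + c * e1 = 0"
    for a b :: "('k, 'r) kronecker"
    by (metis distrib_right) (metis mult.assoc, metis mult_zero_left,
        metis distrib_right add.right_inverse mult_zero_left)
  have "left_module (P2 :: (('k, 'r) kronecker, _) module)"
    by (intro left_module.intro left_module_axioms.intro abelian_groupI)
      (auto simp: P2_def left_ideal_module_def image_iff ex distrib_left distrib_right mult.assoc
        add.commute add.left_commute)
  moreover have "e1 \<in> carrier (P2 :: (('k, 'r) kronecker, _) module)"
    by (auto simp: P2_def left_ideal_module_def image_iff intro: exI[of _ 1])
  moreover have "e1 \<odot>\<^bsub>P2\<^esub> e1 = (e1 :: ('k, 'r) kronecker)" "e1 \<noteq> \<zero>\<^bsub>P2 :: (('k, 'r) kronecker, _) module\<^esub>"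
    by (simp_all add: P2_def left_ideal_module_def kronecker_arith)
  moreover have "carrier P2 = range (\<lambda>a. a \<odot>\<^bsub>P2\<^esub> (e1 :: ('k, 'r) kronecker))"
    by (simp add: P2_def left_ideal_module_def)
  ultimately show "e1_generator (P2 :: (('k, 'r) kronecker, _) module) e1"
    by (intro e1_generator.intro e1_generator_axioms.intro)
qed

lemma x_elem_e1: "x_elem v * e1 = x_elem v"
  by (simp add: kronecker_arith)

lemma X_mod_generator:
  fixes U :: "('k::field ^ 'r::finite) set"
  assumes U: "vec.subspace U"
  shows "\<exists>x. e1_generator (X_mod U) x \<and> relations (X_mod U) x = U"
proof -
  interpret P2: e1_generator "P2 :: (('k, 'r) kronecker, _) module" e1
    by (rule P2_generator)
  let ?S = "x_elem ` U"
  obtain u where u: "basis_tuple U u"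
    using basis_tuple_exists[OF U] by blast
  then have X: "X_mod U = quotient_module P2 ?S"
    by (simp add: X_mod_eq[OF u] X_of_tuple_def cokernel_def presentation_hom_image basis_tuple_def)
  have S: "submodule_of ?S P2"
    unfolding submodule_of_def
  proof (intro conjI ballI allI)
    show "?S \<subseteq> carrier P2"
      by (auto simp: P2_def left_ideal_module_def) (metis x_elem_e1 rangeI)
    show "\<zero>\<^bsub>P2\<^esub> \<in> ?S"
      using vec.subspace_0[OF U] x_elem_zero by (force simp: P2_def left_ideal_module_def)
  next
    fix x y assume "x \<in> ?S" "y \<in> ?S"
    then show "x \<oplus>\<^bsub>P2\<^esub> y \<in> ?S"
      using vec.subspace_add[OF U]
      by (auto simp: P2_def left_ideal_module_def simp flip: x_elem_add)
  next
    fix a x assume "x \<in> ?S"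
    then show "a \<odot>\<^bsub>P2\<^esub> x \<in> ?S"
      using vec.subspace_scale[OF U]
      by (auto simp: P2_def left_ideal_module_def times_x_elem[of a] simp flip: x_elem_scale)
  qed
  note proj = quotient_module_projection[OF P2.left_module_axioms S, folded X]
  \<comment> \<open>The coefficient at the stationary path of vertex 1 is 1 for \<open>e1\<close>
    and 0 for every \<open>x_elem v\<close>.\<close>
  have e1: "e1 \<notin> ?S"
    by (auto simp: kronecker_arith)
  have gen: "?S +>\<^bsub>P2\<^esub> e1 \<noteq> \<zero>\<^bsub>X_mod U\<^esub>"
    using e1 by (simp add: proj(3)[OF P2.gen_closed])
  have "x_elem v \<odot>\<^bsub>P2\<^esub> e1 = x_elem v" for v :: "'k ^ 'r"
    by (simp add: P2_def left_ideal_module_def x_elem_e1)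
  then have "?S +>\<^bsub>P2\<^esub> (x_elem v \<odot>\<^bsub>P2\<^esub> e1) = \<zero>\<^bsub>X_mod U\<^esub> \<longleftrightarrow> v \<in> U" for v
    using proj(3)[OF P2.smult_closed[OF P2.gen_closed, of "x_elem v"]] inj_image_mem_iff[OF inj_x_elem]
    by metis
  then show ?thesis
    using P2.e1_generator_image[OF proj(1,2) gen] by blast
qed

lemma (in e1_generator) isomorphic_X_mod: "M \<cong>\<^sub>m X_mod (relations M m)"
proof -
  obtain x where "e1_generator (X_mod (relations M m)) x"
    "relations (X_mod (relations M m)) x = relations M m"
    using X_mod_generator[OF subspace_relations] by blast
  then show ?thesis
    by (rule isomorphic_if_relations_eq)
qed

section \<open>Isomorphism classes\<close>

text \<open>Coordinates with respect to a finite basis, numbered by an injection into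
  \<open>nat\<close>, embed the carrier into \<open>nat \<Rightarrow> 'k\<close>; the structure is
  then transported along this embedding.\<close>

lemma std_module_exists:
  fixes M :: "(('k::field, 'r::finite) kronecker, 'm) module"
  assumes "fd_module M"
  shows "\<exists>N :: ('k, 'r) std_module. M \<cong>\<^sub>m N"
proof -
  obtain B where B: "kbasis M (carrier M) B" and M: "left_module M"
    using assms by (auto simp: fd_module_def has_kdim_def)
  then have "finite B" by (simp add: kbasis_def)
  then obtain h :: "'m \<Rightarrow> nat" where h: "inj_on h B"
    using finite_imp_inj_to_nat_seg by metis
  have "\<exists>c. \<forall>v\<in>carrier M. c v \<in> B \<rightarrow>\<^sub>E UNIV \<and> v = finsum M (\<lambda>b. scalar (c v b) \<odot>\<^bsub>M\<^esub> b) B"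
    using B unfolding kbasis_def by (intro bchoice) blast
  then obtain c where c: "\<And>v. v \<in> carrier M \<Longrightarrow> c v \<in> B \<rightarrow>\<^sub>E UNIV"
    "\<And>v. v \<in> carrier M \<Longrightarrow> v = finsum M (\<lambda>b. scalar (c v b) \<odot>\<^bsub>M\<^esub> b) B"
    by blast
  have "inj_on (\<lambda>v i. c v (inv_into B h i)) (carrier M)"
  proof (rule inj_onI)
    fix v w assume vw: "v \<in> carrier M" "w \<in> carrier M"
      and eq: "(\<lambda>i. c v (inv_into B h i)) = (\<lambda>i. c w (inv_into B h i))"
    have "c v b = c w b" if "b \<in> B" for b
      using fun_cong[OF eq, of "h b"] that h by simp
    then have "c v = c w"
      using c(1)[OF vw(1)] c(1)[OF vw(2)] by (rule PiE_ext[rotated 2])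
    then show "v = w"
      using c(2)[OF vw(1)] c(2)[OF vw(2)] by simp
  qed
  then show ?thesis
    by (rule transport_module[OF M])
qed

text \<open>Equal classes give an isomorphism only through a common member, so the class of
  \<open>M\<close> must be shown non-empty. The generator supplies the finite dimension for this,
  and its image in \<open>L\<close> does so for \<open>L\<close>.\<close>

lemma iso_class_eq_iff:
  fixes M :: "(('k::field, 'r::finite) kronecker, 'm) module"
    and N :: "(('k, 'r) kronecker, 'n) module"
  assumes "e1_generator M m" "left_module N"
  shows "iso_class M = iso_class N \<longleftrightarrow> M \<cong>\<^sub>m N"
proof
  assume "M \<cong>\<^sub>m N"
  then show "iso_class M = iso_class N"
    by (auto simp: iso_class_def intro: module_isomorphic_trans module_isomorphic_sym)
next
  assume eq: "iso_class M = iso_class N"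
  interpret M: e1_generator M m by fact
  obtain L :: "('k, 'r) std_module" where L: "M \<cong>\<^sub>m L"
    using std_module_exists[OF M.fd_module] by blast
  then obtain l where "e1_generator L l"
    using M.e1_generator_isomorphic by blast
  then have "L \<in> iso_class M"
    using L by (simp add: iso_class_def e1_generator.fd_module)
  then show "M \<cong>\<^sub>m N"
    unfolding eq using L by (auto simp: iso_class_def intro: module_isomorphic_trans module_isomorphic_sym)
qed

text \<open>The dimension \<open>CARD('r) - d\<close> at vertex 2 corresponds to \<open>d\<close>
  relations; the bound on \<open>d\<close> keeps the subtraction of naturals from truncating.
  Generators are carried between \<open>M\<close> and a standard representative along
  isomorphisms.\<close>

lemma iso_class_in_Q_classes_iff:
  fixes M :: "(('k::field, 'r::finite) kronecker, 'm) module"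
  assumes "fd_module M" "d \<le> CARD('r)"
  shows "iso_class M \<in> Q_classes d \<longleftrightarrow> (\<exists>m. e1_generator M m \<and> vec.dim (relations M m) = d)"
proof
  assume "iso_class M \<in> Q_classes d"
  then obtain N :: "('k, 'r) std_module" where eq: "iso_class M = iso_class N"
    and N: "indecomposable N" "has_dimension_vector N (1, CARD('r) - d)"
    by (auto simp: Q_classes_def)
  obtain n where "e1_generator N n"
    using indecomposable_generator[OF N] by blast
  then interpret N: e1_generator N n .
  have "vec.dim (relations N n) = d"
    using N(2) assms(2) unfolding N.has_dimension_vector_iff by linarith
  moreover have "N \<cong>\<^sub>m M"
    using eq iso_class_eq_iff[of N n M] N.e1_generator_axioms assms(1) by (simp add: fd_module_def)
  ultimately show "\<exists>m. e1_generator M m \<and> vec.dim (relations M m) = d"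
    using N.e1_generator_isomorphic by metis
next
  assume "\<exists>m. e1_generator M m \<and> vec.dim (relations M m) = d"
  then obtain m where "e1_generator M m" and dim: "vec.dim (relations M m) = d"
    by blast
  then interpret M: e1_generator M m by simp
  obtain N :: "('k, 'r) std_module" where N: "M \<cong>\<^sub>m N"
    using std_module_exists[OF assms(1)] by blast
  then obtain n where "e1_generator N n" and rel: "relations N n = relations M m"
    using M.e1_generator_isomorphic by blast
  then interpret N: e1_generator N n by simp
  have "iso_class M = iso_class N"
    using N iso_class_eq_iff[OF M.e1_generator_axioms N.left_module_axioms] by simp
  moreover have "has_dimension_vector N (1, CARD('r) - d)"
    using assms(2) dim rel unfolding N.has_dimension_vector_iff by simp
  ultimately show "iso_class M \<in> Q_classes d"
    using N.indecomposable by (auto simp: Q_classes_def)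
qed

lemma subspace_of_dim_exists:
  fixes U :: "('k::field ^ 'r::finite) set"
  assumes "c \<le> vec.dim U" "vec.subspace U"
  shows "\<exists>V. V \<subseteq> U \<and> vec.subspace V \<and> vec.dim V = c"
proof -
  obtain B where B: "B \<subseteq> U" "vec.independent B" "card B = vec.dim U"
    using vec.basis_exists[of U] by metis
  obtain C where C: "C \<subseteq> B" "card C = c"
    using assms(1) B(3) obtain_subset_with_card_n by metis
  have "vec.span C \<subseteq> U"
    using B(1) C(1) assms(2) by (intro vec.span_minimal) auto
  moreover have "vec.dim (vec.span C) = c"
    using B(2) C vec.dim_eq_card_independent[of C] vec.independent_mono by (metis vec.dim_span)
  ultimately show ?thesis
    using vec.subspace_span by blast
qed

theorem proposition2p2p2:
  fixes M :: "(('k::alg_closed_field, 'r::finite) kronecker, 'm) module"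
  assumes "CARD('r) \<ge> 2"
    and "indecomposable M"
  shows
    "(\<forall>d. 1 \<le> d \<and> d < CARD('r) \<and> iso_class M \<in> Q_classes d \<longrightarrow>
        (\<exists>U\<in>Gr d. M \<cong>\<^sub>m X_mod U)) \<and>
     (\<forall>d. 1 \<le> d \<and> d < CARD('r) \<longrightarrow>
        bij_betw (\<lambda>U :: ('k ^ 'r) set. iso_class (X_mod U)) (Gr d) (Q_classes d)) \<and>
     (\<forall>c d. 1 \<le> c \<and> c \<le> d \<and> d < CARD('r) \<and> iso_class M \<in> Q_classes d \<longrightarrow>
        (\<exists>(N :: ('k, 'r) std_module) \<pi>. iso_class N \<in> Q_classes c \<and> \<pi> \<in> module_epis N M))"
proof (intro conjI allI impI)
  have fd: "fd_module M"
    using assms(2) by (simp add: indecomposable_def)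
  {
    fix d assume "1 \<le> d \<and> d < CARD('r) \<and> iso_class M \<in> Q_classes d"
    \<comment> \<open>The witness is \<open>relations M m\<close> for a generator
      \<open>m\<close>.\<close>
    then show "\<exists>U\<in>Gr d. M \<cong>\<^sub>m X_mod U"
      using iso_class_in_Q_classes_iff[OF fd, of d] e1_generator.isomorphic_X_mod
        e1_generator.subspace_relations by (fastforce simp: Gr_def)
  next
    fix d assume "1 \<le> d \<and> d < CARD('r)"
    then have d: "d \<le> CARD('r)" by simp
    show "bij_betw (\<lambda>U :: ('k ^ 'r) set. iso_class (X_mod U)) (Gr d) (Q_classes d)"
      unfolding bij_betw_def
    proof
      show "inj_on (\<lambda>U :: ('k ^ 'r) set. iso_class (X_mod U)) (Gr d)"
      proof (rule inj_onI)
        fix U V :: "('k ^ 'r) set"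
        assume "U \<in> Gr d" "V \<in> Gr d" and eq: "iso_class (X_mod U) = iso_class (X_mod V)"
        then obtain x y where x: "e1_generator (X_mod U) x" "relations (X_mod U) x = U"
          and y: "e1_generator (X_mod V) y" "relations (X_mod V) y = V"
          using X_mod_generator by (metis (mono_tags, lifting) Gr_def mem_Collect_eq)
        have "X_mod U \<cong>\<^sub>m X_mod V"
          using eq iso_class_eq_iff[OF x(1) e1_generator.axioms(1)[OF y(1)]] by blast
        \<comment> \<open>The isomorphism moves \<open>x\<close> to a second generator of
          \<open>X_mod V\<close>, whose relations are \<open>U\<close>; they must agree with those
          of \<open>y\<close>, which are \<open>V\<close>.\<close>
        then obtain y' where "e1_generator (X_mod V) y'" "relations (X_mod V) y' = U"
          using e1_generator.e1_generator_isomorphic[OF x(1)] x(2) by metis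
        then show "U = V"
          using e1_generator.relations_unique[OF y(1)] y(2) by metis
      qed
      show "(\<lambda>U :: ('k ^ 'r) set. iso_class (X_mod U)) ` Gr d = Q_classes d"
      proof
        show "(\<lambda>U :: ('k ^ 'r) set. iso_class (X_mod U)) ` Gr d \<subseteq> Q_classes d"
        proof
          fix Z assume "Z \<in> (\<lambda>U :: ('k ^ 'r) set. iso_class (X_mod U)) ` Gr d"
          then obtain U :: "('k ^ 'r) set" where U: "vec.subspace U" "vec.dim U = d"
            and Z: "Z = iso_class (X_mod U)"
            by (auto simp: Gr_def)
          then show "Z \<in> Q_classes d"
            using X_mod_generator[OF U(1)] d
            by (metis e1_generator.fd_module iso_class_in_Q_classes_iff)
        qed
        show "Q_classes d \<subseteq> (\<lambda>U :: ('k ^ 'r) set. iso_class (X_mod U)) ` Gr d"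
        proof
          fix Z :: "('k, 'r) std_module set" assume Z: "Z \<in> Q_classes d"
          then obtain L :: "('k, 'r) std_module" where L: "Z = iso_class L" "fd_module L"
            by (auto simp: Q_classes_def indecomposable_def)
          then obtain l where l: "e1_generator L l" "vec.dim (relations L l) = d"
            using Z d iso_class_in_Q_classes_iff by blast
          then obtain U where U: "U \<in> Gr d" "L \<cong>\<^sub>m X_mod U"
            using e1_generator.isomorphic_X_mod e1_generator.subspace_relations
            by (fastforce simp: Gr_def)
          then have "left_module (X_mod U)"
            by (simp add: module_isomorphic_def)
          then have "iso_class L = iso_class (X_mod U)"
            using iso_class_eq_iff[OF l(1)] U(2) by blast
          then show "Z \<in> (\<lambda>U :: ('k ^ 'r) set. iso_class (X_mod U)) ` Gr d"
            using L(1) U(1) by blast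
        qed
      qed
    qed
  next
    fix c d assume *: "1 \<le> c \<and> c \<le> d \<and> d < CARD('r) \<and> iso_class M \<in> Q_classes d"
    then obtain m where m: "e1_generator M m" "vec.dim (relations M m) = d"
      using iso_class_in_Q_classes_iff[OF fd, of d] by auto
    \<comment> \<open>Fewer relations give a larger module: any \<open>c\<close>-dimensional
      \<open>V\<close> inside the relations of \<open>M\<close> makes \<open>X_mod V\<close> map
      onto \<open>M\<close>.\<close>
    then obtain V where V: "V \<subseteq> relations M m" "vec.subspace V" "vec.dim V = c"
      using * subspace_of_dim_exists e1_generator.subspace_relations by metis
    obtain x where x: "e1_generator (X_mod V) x" "relations (X_mod V) x = V"
      using X_mod_generator[OF V(2)] by blast
    \<comment> \<open>The claim asks for a standard module, so \<open>X_mod V\<close> is replaced by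
      an isomorphic copy with the same relations.\<close>
    obtain N :: "('k, 'r) std_module" where "X_mod V \<cong>\<^sub>m N"
      using std_module_exists e1_generator.fd_module[OF x(1)] by blast
    then obtain n where n: "e1_generator N n" "relations N n = V"
      using e1_generator.e1_generator_isomorphic[OF x(1)] x(2) by metis
    have "iso_class N \<in> Q_classes c"
      using n V(3) * e1_generator.fd_module[OF n(1)] by (subst iso_class_in_Q_classes_iff) auto
    moreover obtain \<pi> where "\<pi> \<in> module_epis N M"
      using e1_generator.generator_map[OF n(1) m(1)] n(2) V(1) by auto
    ultimately show "\<exists>(N :: ('k, 'r) std_module) \<pi>. iso_class N \<in> Q_classes c \<and> \<pi> \<in> module_epis N M"
      by blast
  }
qed

end
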